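(* Let $R\in\mathrm M(\Omega)$ be Markov and irreducible in the sense that $R_s\otimes R_t\ll R_{s,t}\ll R_s\otimes R_t$ for all $0\le s<t\le1$. Let $\mathcal T=\{t_1,\dots,t_K\}\subset[0,1]$ be finite and $\mu_t\in\mathrm P(\mathcal X)$ for $t\in\mathcal T$. Suppose the extended Schrödinger problem $$H(P|R)\to\min;\qquad P\in\mathrm P(\Omega):\ P_t=\mu_t\ \ \forall t\in\mathcal T$$ admits a (unique) solution $P$. Then there exist a regular additive functional $A$ and measurable functions $f_i:\mathcal X\to[-\infty,+\infty)$, $1\le i\le K$, such that $$\frac{dP}{dR}=\exp\big(A([0,1])\big)\quad R\text{-a.e.},$$ $A(I)=0$ for every interval $I\subset[0,1]$ with $I\cap\mathcal T=\emptyset$, $A(I)$ is $\sigma(X_{I\cap\mathcal T})$-measurable for every interval $I\subset[0,1]$, and $$A([0,1])=\sum_{i=1}^K f_i(X_{t_i}).$$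
   Context: $\mathcal X$ is a Polish space, $\Omega=C([0,1];\mathcal X)$ is the set of continuous paths with the topology of uniform convergence and its Borel $\sigma$-field, and $X_t(\omega)=\omega(t)$ is the canonical process; for $\mathcal T\subset[0,1]$, $X_{\mathcal T}=(X_t)_{t\in\mathcal T}$. $\mathrm M(\Omega)$ and $\mathrm P(\Omega)$ are the sets of (nonnegative) Borel measures and Borel probability measures on $\Omega$; $Q_{t_1,\dots,t_k}$ is the image of $Q$ by $(X_{t_1},\dots,X_{t_k})$. A path measure $Q\in \mathrm M(\Omega)$ is conditionable if $Q_t$ is $\sigma$-finite for every $t\in[0,1]$. $Q$ is Markov if it is conditionable and for every $t\in[0,1]$, $A\in\sigma(X_{[0,t]})$, $B\in\sigma(X_{[t,1]})$: $Q(A\cap B\mid X_t)=Q(A\mid X_t)Q(B\mid X_t)$, $Q$-a.e. Relative entropy: $H(P|R)=E_P[\log \frac{dP}{dR}]$ ; precisely, for $R$ conditionable (possibly unbounded) and $P\in\mathrm P(\Omega)$, if $W:\Omega\to[0,\infty)$ is measurable with $z_W=\int e^{-W}dR<\infty$ and $\int W\,dP<\infty$, put $R_W=z_W^{-1}e^{-W}R$ and $H(P|R)=H(P|R_W)-\int W\,dP-\log z_W\in(-\infty,\infty]$, where $H(P|R_W)$ is the usual relative entropy between probability measures; the value does not depend on $W$, and $H(P|R)$ is defined whenever such a $W$ exists. A solution of the minimization problem is a minimizer with $H(P|R)<\infty$. Contents: let $\mathcal I$ be the collection of all finite unions of intervals of $[0,1]$. A content is a map $\mu:\mathcal I\to[-\infty,+\infty)$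 with $\mu(\emptyset)=0$ and $\mu(I_1\cup I_2)=\mu(I_1)+\mu(I_2)$ whenever $I_1\cap I_2=\emptyset$. $\mathfrak C([0,1])$ is the set of contents. A content $\mu$ is regular if one of the following two equivalent properties holds (all $\sigma,\tau\in[0,1]$): (i) for all $0\le s\le t\le1$ with $(s,t)\ne(0,1)$, $\lim \mu([\sigma,\tau])=\mu([s,t])$ as $(\sigma,\tau)\to(s,t)$ with $\sigma\le s,\ \tau\ge t$; and for all $0\le s<t\le1$, $\lim\mu([\sigma,\tau])$ exists as $(\sigma,\tau)\to(s,t)$ with $\sigma>s,\ \tau<t$; (ii) for all $0\le s<t\le1$, $\lim\mu((\sigma,\tau))=\mu((s,t))$ as $(\sigma,\tau)\to(s,t)$ with $\sigma\ge s,\ \tau\le t$; and for all $0\le s\le t\le1$ with $(s,t)\neq(0,1)$, $\lim\mu((\sigma,\tau))$ exists as $(\sigma,\tau)\to(s,t)$ with $\sigma<s,\ \tau>t$. An additive functional is a map $A:\Omega\to\mathfrak C([0,1])$ such that for every $I\in\mathcal I$, $A(I)$ is $\sigma(X_t,\,t\in I)$-measurable. It is regular if all its values are regular contents. Convention: $\exp(-\infty)=0$. *)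

theory Defs
  imports "HOL-Probability.Probability"
begin

section \<open>Path space\<close>

text \<open>Paths are functions on \<open>real\<close> that are \<open>undefined\<close> outside \<open>[0,1]\<close>; since \<open>[0,1]\<close> is
  compact, the boundedness built into \<^const>\<open>cfunspace\<close> is automatic. Its metric is the
  supremum metric. The topology of uniform convergence does not depend on which
  metric inducing the topology of the state space is used.\<close>

definition path_metric :: "(real \<Rightarrow> 'a::polish_space) metric" where
  "path_metric = cfunspace (top_of_set {0..1}) euclidean_metric"

abbreviation paths :: "(real \<Rightarrow> 'a::polish_space) set" where
  "paths \<equiv> mspace path_metric"

definition path_borel :: "(real \<Rightarrow> 'a::polish_space) measure" where
  "path_borel = sigma paths {U. openin (mtopology_of path_metric) U}"

abbreviation (input) canonical :: "real \<Rightarrow> (real \<Rightarrow> 'a) \<Rightarrow> 'a" where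
  "canonical t \<omega> \<equiv> \<omega> t"

text \<open>The \<open>\<sigma>\<close>-field generated by the restriction of the canonical process to \<open>S\<close>.\<close>

definition path_sigma :: "real set \<Rightarrow> (real \<Rightarrow> 'a::polish_space) measure" where
  "path_sigma S =
     vimage_algebra paths (\<lambda>\<omega>. \<lambda>t\<in>S. canonical t \<omega>) (\<Pi>\<^sub>M t\<in>S. borel)"

definition marginal :: "(real \<Rightarrow> 'a::polish_space) measure \<Rightarrow> real \<Rightarrow> 'a measure" where
  "marginal Q t = distr Q borel (canonical t)"

definition marginal2 ::
    "(real \<Rightarrow> 'a::polish_space) measure \<Rightarrow> real \<Rightarrow> real \<Rightarrow> ('a \<times> 'a) measure" where
  "marginal2 Q s t = distr Q (borel \<Otimes>\<^sub>M borel) (\<lambda>\<omega>. (canonical s \<omega>, canonical t \<omega>))"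


section \<open>Markov and irreducible path measures\<close>

definition conditionable :: "(real \<Rightarrow> 'a::polish_space) measure \<Rightarrow> bool" where
  "conditionable Q \<longleftrightarrow>
     sets Q = sets path_borel \<and> (\<forall>t\<in>{0..1}. sigma_finite_measure (marginal Q t))"

text \<open>Conditional expectations of nonnegative functions are used because \<open>Q\<close> may be unbounded,
  so that indicators need not be integrable.\<close>

definition cond_prob_at ::
    "(real \<Rightarrow> 'a::polish_space) measure \<Rightarrow> real \<Rightarrow> (real \<Rightarrow> 'a) set \<Rightarrow> (real \<Rightarrow> 'a) \<Rightarrow> ennreal" where
  "cond_prob_at Q t A = nn_cond_exp Q (path_sigma {t}) (indicator A)"

definition Markov :: "(real \<Rightarrow> 'a::polish_space) measure \<Rightarrow> bool" where
  "Markov Q \<longleftrightarrow> conditionable Q \<and>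
     (\<forall>t\<in>{0..1}. \<forall>A\<in>sets (path_sigma {0..t}). \<forall>B\<in>sets (path_sigma {t..1}).
        AE \<omega> in Q. cond_prob_at Q t (A \<inter> B) \<omega> = cond_prob_at Q t A \<omega> * cond_prob_at Q t B \<omega>)"

definition irreducible_path_measure :: "(real \<Rightarrow> 'a::polish_space) measure \<Rightarrow> bool" where
  "irreducible_path_measure R \<longleftrightarrow>
     (\<forall>s t. 0 \<le> s \<and> s < t \<and> t \<le> 1 \<longrightarrow>
        absolutely_continuous (marginal2 R s t) (marginal R s \<Otimes>\<^sub>M marginal R t) \<and>
        absolutely_continuous (marginal R s \<Otimes>\<^sub>M marginal R t) (marginal2 R s t))"


section \<open>Relative entropy and the extended Schroedinger problem\<close>

text \<open>Usual relative entropy \<open>H(P|Q)\<close> of probability measures. The library's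
  \<^const>\<open>KL_divergence\<close> is a Bochner integral and is only meaningful in the first case; as the
  negative part of \<open>log (dP/dQ)\<close> is always \<open>P\<close>-integrable, the value is \<open>\<infinity>\<close> otherwise.\<close>

definition rel_entropy_prob :: "'b measure \<Rightarrow> 'b measure \<Rightarrow> ereal" where
  "rel_entropy_prob P Q =
     (if absolutely_continuous Q P \<and> integrable P (entropy_density (exp 1) Q P)
      then ereal (KL_divergence (exp 1) Q P) else \<infinity>)"

definition entropy_weight :: "'b measure \<Rightarrow> 'b measure \<Rightarrow> ('b \<Rightarrow> real) \<Rightarrow> bool" where
  "entropy_weight P R W \<longleftrightarrow>
     W \<in> borel_measurable R \<and> (\<forall>\<omega>\<in>space R. 0 \<le> W \<omega>) \<and>
     integrable R (\<lambda>\<omega>. exp (- W \<omega>)) \<and> integrable P W"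

definition weight_norm :: "'b measure \<Rightarrow> ('b \<Rightarrow> real) \<Rightarrow> real" where
  "weight_norm R W = (\<integral>\<omega>. exp (- W \<omega>) \<partial>R)"

definition weighted_measure :: "'b measure \<Rightarrow> ('b \<Rightarrow> real) \<Rightarrow> 'b measure" where
  "weighted_measure R W = density R (\<lambda>\<omega>. ennreal (exp (- W \<omega>) / weight_norm R W))"

definition rel_entropy_weighted :: "'b measure \<Rightarrow> 'b measure \<Rightarrow> ('b \<Rightarrow> real) \<Rightarrow> ereal" where
  "rel_entropy_weighted P R W =
     rel_entropy_prob P (weighted_measure R W) - ereal (\<integral>\<omega>. W \<omega> \<partial>P) - ereal (ln (weight_norm R W))"

definition rel_entropy_defined :: "'b measure \<Rightarrow> 'b measure \<Rightarrow> bool" where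
  "rel_entropy_defined P R \<longleftrightarrow> (\<exists>W. entropy_weight P R W)"

text \<open>The value does not depend on the chosen weight; it is meaningful only under
  \<^const>\<open>rel_entropy_defined\<close>.\<close>

definition rel_entropy :: "'b measure \<Rightarrow> 'b measure \<Rightarrow> ereal" where
  "rel_entropy P R = rel_entropy_weighted P R (SOME W. entropy_weight P R W)"

definition schroedinger_feasible ::
    "real set \<Rightarrow> (real \<Rightarrow> 'a::polish_space measure) \<Rightarrow> (real \<Rightarrow> 'a) measure \<Rightarrow> bool" where
  "schroedinger_feasible T \<mu> P \<longleftrightarrow>
     sets P = sets path_borel \<and> prob_space P \<and> (\<forall>t\<in>T. marginal P t = \<mu> t)"

definition schroedinger_solution ::
    "(real \<Rightarrow> 'a::polish_space) measure \<Rightarrow> real set \<Rightarrow> (real \<Rightarrow> 'a measure) \<Rightarrow>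
     (real \<Rightarrow> 'a) measure \<Rightarrow> bool" where
  "schroedinger_solution R T \<mu> P \<longleftrightarrow>
     schroedinger_feasible T \<mu> P \<and> rel_entropy_defined P R \<and> rel_entropy P R < \<infinity> \<and>
     (\<forall>P'. schroedinger_feasible T \<mu> P' \<and> rel_entropy_defined P' R \<longrightarrow>
        rel_entropy P R \<le> rel_entropy P' R)"


section \<open>Contents and additive functionals\<close>

definition unit_intervals :: "real set set" where
  "unit_intervals = {I. is_interval I \<and> I \<subseteq> {0..1}}"

definition interval_unions :: "real set set" where
  "interval_unions = {\<Union>F |F. finite F \<and> F \<subseteq> unit_intervals}"

definition is_content :: "(real set \<Rightarrow> ereal) \<Rightarrow> bool" where
  "is_content m \<longleftrightarrow>
     m {} = 0 \<and> (\<forall>I\<in>interval_unions. m I \<noteq> \<infinity>) \<and>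
     (\<forall>I\<in>interval_unions. \<forall>J\<in>interval_unions. I \<inter> J = {} \<longrightarrow> m (I \<union> J) = m I + m J)"

text \<open>Limits of contents are taken in \<open>[-\<infinity>,\<infinity>)\<close>, hence the requirement \<open>l \<noteq> \<infinity>\<close>.\<close>

definition regular_closed :: "(real set \<Rightarrow> ereal) \<Rightarrow> bool" where
  "regular_closed m \<longleftrightarrow>
     (\<forall>s t. 0 \<le> s \<and> s \<le> t \<and> t \<le> 1 \<and> (s, t) \<noteq> (0, 1) \<longrightarrow>
        ((\<lambda>(\<sigma>, \<tau>). m {\<sigma>..\<tau>}) \<longlongrightarrow> m {s..t})
          (at (s, t) within {(\<sigma>, \<tau>). \<sigma> \<in> {0..1} \<and> \<tau> \<in> {0..1} \<and> \<sigma> \<le> s \<and> t \<le> \<tau>})) \<and>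
     (\<forall>s t. 0 \<le> s \<and> s < t \<and> t \<le> 1 \<longrightarrow>
        (\<exists>l. l \<noteq> \<infinity> \<and> ((\<lambda>(\<sigma>, \<tau>). m {\<sigma>..\<tau>}) \<longlongrightarrow> l)
          (at (s, t) within {(\<sigma>, \<tau>). \<sigma> \<in> {0..1} \<and> \<tau> \<in> {0..1} \<and> s < \<sigma> \<and> \<tau> < t})))"

definition regular_open :: "(real set \<Rightarrow> ereal) \<Rightarrow> bool" where
  "regular_open m \<longleftrightarrow>
     (\<forall>s t. 0 \<le> s \<and> s < t \<and> t \<le> 1 \<longrightarrow>
        ((\<lambda>(\<sigma>, \<tau>). m {\<sigma><..<\<tau>}) \<longlongrightarrow> m {s<..<t})
          (at (s, t) within {(\<sigma>, \<tau>). \<sigma> \<in> {0..1} \<and> \<tau> \<in> {0..1} \<and> s \<le> \<sigma> \<and> \<tau> \<le> t})) \<and>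
     (\<forall>s t. 0 \<le> s \<and> s \<le> t \<and> t \<le> 1 \<and> (s, t) \<noteq> (0, 1) \<longrightarrow>
        (\<exists>l. l \<noteq> \<infinity> \<and> ((\<lambda>(\<sigma>, \<tau>). m {\<sigma><..<\<tau>}) \<longlongrightarrow> l)
          (at (s, t) within {(\<sigma>, \<tau>). \<sigma> \<in> {0..1} \<and> \<tau> \<in> {0..1} \<and> \<sigma> < s \<and> t < \<tau>})))"

text \<open>Either condition is meant to characterize regularity. They need not agree for contents
  that take the value \<open>-\<infinity>\<close>, nor for the limits at the endpoints of \<open>[0,1]\<close>, so both are
  required.\<close>

definition regular_content :: "(real set \<Rightarrow> ereal) \<Rightarrow> bool" where
  "regular_content m \<longleftrightarrow> is_content m \<and> regular_closed m \<and> regular_open m"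

definition additive_functional ::
    "((real \<Rightarrow> 'a::polish_space) \<Rightarrow> real set \<Rightarrow> ereal) \<Rightarrow> bool" where
  "additive_functional A \<longleftrightarrow>
     (\<forall>\<omega>\<in>paths. is_content (A \<omega>)) \<and>
     (\<forall>I\<in>interval_unions. (\<lambda>\<omega>. A \<omega> I) \<in> borel_measurable (path_sigma I))"

definition regular_additive_functional ::
    "((real \<Rightarrow> 'a::polish_space) \<Rightarrow> real set \<Rightarrow> ereal) \<Rightarrow> bool" where
  "regular_additive_functional A \<longleftrightarrow>
     additive_functional A \<and> (\<forall>\<omega>\<in>paths. regular_content (A \<omega>))"

definition exp_ereal :: "ereal \<Rightarrow> ennreal" where
  "exp_ereal x = (case x of ereal r \<Rightarrow> ennreal (exp r) | PInfty \<Rightarrow> \<infinity> | MInfty \<Rightarrow> 0)"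

end

theory Submission
  imports Defs
begin

text \<open>
  The minimizer has a product density because it cannot be improved by exchanging coordinates
  between pairs of sample points.

  Write \<open>P = h R\<close>. Whatever weight is used to define it, \<open>H(P|R)\<close> is the integral of \<open>h ln h\<close>
  against \<open>R\<close>, or \<open>\<infinity>\<close> if it is not integrable (\<open>rel_entropy_density\<close>). Hence \<open>h\<close> can be tested against perturbations \<open>k\<close> that
  vanish off a set of finite \<open>R\<close>-measure and do not change the marginals at the times in \<open>T\<close>; the
  weight can be put to zero where \<open>k\<close> lives, so that the perturbed measure remains admissible even
  though integrability of the original weight may be lost there
  (\<open>schroedinger_solution_first_variation\<close>).

  The first perturbation replaces \<open>h\<close> by \<open>g(X\<^sub>T)\<close>, with \<open>g\<close> the density of the law of \<open>X\<^sub>T\<close>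
  under \<open>P\<close> with respect to its law under \<open>R\<close>, on a set where \<open>g\<close> is bounded from above and
  below. Strict convexity of \<open>x ln x\<close> forces \<open>h = g(X\<^sub>T)\<close>
  (\<open>schroedinger_density_sufficient\<close>). This is conditional Jensen in a localized form; the global
  form is not available, as the entropy of \<open>g(X\<^sub>T) R\<close> need not be defined beforehand.

  The Markov property and irreducibility enter through one consequence: the law of \<open>X\<^sub>T\<close> under
  \<open>R\<close> has the null sets of a product \<open>m\<close> of probability measures
  (\<open>law_null_iff_product_null\<close>). Draw two independent points \<open>x, y\<close> from \<open>m\<close>, and exchange some
  of their coordinates to get \<open>x', y'\<close>. The pair \<open>(x', y')\<close> again has law \<open>m \<Otimes> m\<close>, and moving a
  little mass from \<open>x', y'\<close> to \<open>x, y\<close> leaves all one-dimensional marginals unchanged. The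
  derivative of the entropy in this direction is \<open>ln (g x) + ln (g y) - ln (g x') - ln (g y')\<close>,
  which is \<open>-\<infinity>\<close> if \<open>g x g y = 0 < g x' g y'\<close>. Minimality thus yields \<open>g x g y \<ge> g x' g y'\<close>
  almost everywhere, and equality by symmetry (\<open>swap_invariant_if_optimal\<close>). For a generic fixed
  \<open>y\<close> and the exchange of a single coordinate \<open>j\<close>, this identity factors \<open>g\<close> into a function of
  \<open>x\<^sub>j\<close> and a function of the other coordinates; splitting off the coordinates one after
  the other gives \<open>g x = \<Prod>\<^sub>s f\<^sub>s(x\<^sub>s)\<close> (\<open>swap_invariant_factorization\<close>). As the identity is
  multiplicative, it covers the zeros of \<open>g\<close> as well, so these come out in product form too.

  The additive functional then puts the atom \<open>ln (f\<^sub>s(X\<^sub>s))\<close> at each time \<open>s \<in> T\<close>. A content with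
  finitely many atoms is regular, because the set of atoms in an interval is locally constant in
  the endpoints on each of the one-sided approaches (\<open>regular_content_atomic\<close>).
\<close>

section \<open>The function \<open>x ln x\<close>\<close>

text \<open>The tangent inequality for the convex function \<open>x ln x\<close>, with the tangent taken at \<open>t\<close> and not
  at \<open>x\<close>: this is what remains usable when \<open>x = 0\<close>.\<close>

lemma mult_ln_diff_le:
  assumes "0 < t" "0 \<le> (x::real)"
  shows "t * ln t - x * ln x \<le> (t - x) * (1 + ln t)"
proof (cases "x = 0")
  case False
  then have x: "0 < x" using assms by simp
  have "ln (t / x) \<le> t / x - 1" using assms x by (intro ln_le_minus_one) simp
  then have "x * (ln t - ln x) \<le> t - x"
    using x assms by (simp add: ln_div field_simps)
  then show ?thesis by (simp add: algebra_simps)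
qed (use assms in \<open>simp add: algebra_simps\<close>)

text \<open>The Bregman divergence of \<open>x ln x\<close>, with its strictness.\<close>

lemma mult_ln_bregman:
  assumes "0 \<le> (a::real)" "0 < b"
  shows "0 \<le> a * ln a - b * ln b - (1 + ln b) * (a - b)"
    and "a * ln a - b * ln b - (1 + ln b) * (a - b) = 0 \<Longrightarrow> a = b"
proof -
  have "0 \<le> a * ln a - b * ln b - (1 + ln b) * (a - b) \<and>
      (a * ln a - b * ln b - (1 + ln b) * (a - b) = 0 \<longrightarrow> a = b)"
  proof (cases "a = 0")
    case False
    then have a: "0 < a" using assms by simp
    have eq: "a * ln a - b * ln b - (1 + ln b) * (a - b) = a * (b / a - 1 - ln (b / a))"
      using a assms by (simp add: ln_div algebra_simps)
    have "ln (b / a) \<le> b / a - 1" using a assms by (intro ln_le_minus_one) simp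
    moreover have "b / a = 1" if "ln (b / a) = b / a - 1"
      using that a assms by (intro ln_eq_minus_one) simp
    ultimately show ?thesis unfolding eq using a by auto
  qed (use assms in \<open>simp add: algebra_simps\<close>)
  then show "0 \<le> a * ln a - b * ln b - (1 + ln b) * (a - b)"
    and "a * ln a - b * ln b - (1 + ln b) * (a - b) = 0 \<Longrightarrow> a = b" by blast+
qed

lemma abs_mult_ln_le:
  assumes "0 \<le> (x::real)" "x \<le> M"
  shows "\<bar>x * ln x\<bar> \<le> 1 + M * M"
proof (cases "x = 0")
  case False
  then have x: "0 < x" using assms by simp
  have "x * ln x \<le> x * (x - 1)" using x by (intro mult_left_mono ln_le_minus_one) auto
  also have "\<dots> \<le> x * x" using x by (simp add: algebra_simps)
  also have "\<dots> \<le> M * M" using x assms by (intro mult_mono) auto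
  finally have "x * ln x \<le> 1 + M * M" by simp
  moreover have "- (x * ln x) \<le> 1 + M * M"
  proof -
    have "x * ln (1 / x) \<le> x * (1 / x - 1)" using x by (intro mult_left_mono ln_le_minus_one) auto
    then have "- (x * ln x) \<le> 1 - x" using x by (simp add: ln_div algebra_simps)
    then show ?thesis using x assms mult_nonneg_nonneg[of M M] by linarith
  qed
  ultimately show ?thesis by (simp add: abs_le_iff)
qed simp

section \<open>Exchanging coordinates between two points of a product space\<close>

text \<open>Two points are treated as a single pair, so that the exchange is an involution of
  the product space with itself.\<close>

definition swap_coords :: "'i set \<Rightarrow> ('i \<Rightarrow> 'b) \<times> ('i \<Rightarrow> 'b) \<Rightarrow> ('i \<Rightarrow> 'b) \<times> ('i \<Rightarrow> 'b)" where
  "swap_coords S z = (override_on (fst z) (snd z) S, override_on (snd z) (fst z) S)"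

lemma swap_coords_involution: "swap_coords S (swap_coords S z) = z"
  by (cases z) (auto simp: swap_coords_def override_on_def fun_eq_iff)

lemma measurable_override_on [measurable (raw)]:
  assumes "S \<subseteq> I"
    and u: "u \<in> measurable N (PiM I M)" and v: "v \<in> measurable N (PiM I M)"
  shows "(\<lambda>w. override_on (u w) (v w) S) \<in> measurable N (PiM I M)"
proof (rule measurable_PiM_single')
  fix i assume i: "i \<in> I"
  have [measurable]: "(\<lambda>w. u w i) \<in> measurable N (M i)" "(\<lambda>w. v w i) \<in> measurable N (M i)"
    using measurable_compose[OF u measurable_component_singleton[OF i]]
      measurable_compose[OF v measurable_component_singleton[OF i]] by simp_all
  show "(\<lambda>w. override_on (u w) (v w) S i) \<in> measurable N (M i)"
    by (cases "i \<in> S") (auto simp: override_on_def)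
next
  show "(\<lambda>w. override_on (u w) (v w) S) \<in> space N \<rightarrow> (\<Pi>\<^sub>E i\<in>I. space (M i))"
  proof
    fix w assume "w \<in> space N"
    then have "u w \<in> space (PiM I M)" "v w \<in> space (PiM I M)"
      using u v by (auto dest: measurable_space)
    then show "override_on (u w) (v w) S \<in> (\<Pi>\<^sub>E i\<in>I. space (M i))"
      using assms(1) by (auto simp: space_PiM override_on_def PiE_iff extensional_def)
  qed
qed

lemma measurable_swap_coords:
  assumes "S \<subseteq> I"
  shows "swap_coords S \<in> measurable (PiM I M \<Otimes>\<^sub>M PiM I M) (PiM I M \<Otimes>\<^sub>M PiM I M)"
  unfolding swap_coords_def using assms by measurable

lemma override_on_merge:
  "override_on (merge S (I - S) (a, b)) (merge S (I - S) (c, d)) S = merge S (I - S) (c, b)"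
  by (auto simp: fun_eq_iff override_on_def merge_def)

context
  fixes M :: "'i \<Rightarrow> 'b measure" and I :: "'i set"
  assumes prob: "\<And>i. prob_space (M i)" and fin_I: "finite I"
begin

text \<open>Splitting the coordinates into \<open>S\<close> and its complement turns the integral into a fourfold
  iterated one; the exchange only permutes the two integrations over the coordinates in \<open>S\<close>.\<close>

lemma nn_integral_swap_coords:
  assumes S: "S \<subseteq> I" and f[measurable]: "f \<in> borel_measurable (PiM I M \<Otimes>\<^sub>M PiM I M)"
  shows "(\<integral>\<^sup>+z. f (swap_coords S z) \<partial>(PiM I M \<Otimes>\<^sub>M PiM I M)) = (\<integral>\<^sup>+z. f z \<partial>(PiM I M \<Otimes>\<^sub>M PiM I M))"
proof -
  let ?m = "PiM I M" and ?A = "PiM S M" and ?B = "PiM (I - S) M" and ?mg = "merge S (I - S)"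
  note [measurable] = measurable_swap_coords[OF S, where M = M]
  have fin: "finite S" "finite (I - S)" using S fin_I by (auto intro: finite_subset)
  have IS: "S \<union> (I - S) = I" using S by auto
  have sf: "sigma_finite_measure ?m"
    by (intro prob_space_imp_sigma_finite prob_space_PiM prob)
  interpret product_sigma_finite M
    by (simp add: product_sigma_finite_def prob prob_space_imp_sigma_finite)
  interpret A: prob_space ?A by (rule prob_space_PiM) (rule prob)
  interpret B: prob_space ?B by (rule prob_space_PiM) (rule prob)
  interpret AB: pair_sigma_finite ?A ?B ..
  interpret BA: pair_sigma_finite ?B ?A ..
  interpret AA: pair_sigma_finite ?A ?A ..
  have mg[measurable]: "?mg \<in> measurable (?A \<Otimes>\<^sub>M ?B) ?m"
    using measurable_merge[of S "I - S" M] unfolding IS .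
  have fold: "(\<integral>\<^sup>+x. F x \<partial>?m) = (\<integral>\<^sup>+a. \<integral>\<^sup>+b. F (?mg (a, b)) \<partial>?B \<partial>?A)"
    if "F \<in> borel_measurable ?m" for F
    using product_nn_integral_fold[of S "I - S" F] that fin unfolding IS by simp
  have split: "(\<integral>\<^sup>+z. F z \<partial>(?m \<Otimes>\<^sub>M ?m)) =
      (\<integral>\<^sup>+a. \<integral>\<^sup>+b. \<integral>\<^sup>+c. \<integral>\<^sup>+d. F (?mg (a, b), ?mg (c, d)) \<partial>?B \<partial>?A \<partial>?B \<partial>?A)"
    if [measurable]: "F \<in> borel_measurable (?m \<Otimes>\<^sub>M ?m)" for F
  proof -
    have "(\<integral>\<^sup>+z. F z \<partial>(?m \<Otimes>\<^sub>M ?m)) = (\<integral>\<^sup>+x. \<integral>\<^sup>+y. F (x, y) \<partial>?m \<partial>?m)"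
      by (rule sigma_finite_measure.nn_integral_fst[OF sf, symmetric]) simp
    also have "\<dots> = (\<integral>\<^sup>+x. \<integral>\<^sup>+c. \<integral>\<^sup>+d. F (x, ?mg (c, d)) \<partial>?B \<partial>?A \<partial>?m)"
      by (rule nn_integral_cong, rule fold) measurable
    also have "\<dots> = (\<integral>\<^sup>+a. \<integral>\<^sup>+b. \<integral>\<^sup>+c. \<integral>\<^sup>+d. F (?mg (a, b), ?mg (c, d)) \<partial>?B \<partial>?A \<partial>?B \<partial>?A)"
      by (rule fold) measurable
    finally show ?thesis .
  qed
  have "(\<integral>\<^sup>+z. f (swap_coords S z) \<partial>(?m \<Otimes>\<^sub>M ?m)) =
      (\<integral>\<^sup>+a. \<integral>\<^sup>+b. \<integral>\<^sup>+c. \<integral>\<^sup>+d. f (?mg (c, b), ?mg (a, d)) \<partial>?B \<partial>?A \<partial>?B \<partial>?A)"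
  proof -
    have "(\<lambda>z. f (swap_coords S z)) \<in> borel_measurable (?m \<Otimes>\<^sub>M ?m)" by measurable
    from split[OF this] show ?thesis
      by (simp add: swap_coords_def override_on_merge)
  qed
  also have "\<dots> = (\<integral>\<^sup>+a. \<integral>\<^sup>+c. \<integral>\<^sup>+b. \<integral>\<^sup>+d. f (?mg (c, b), ?mg (a, d)) \<partial>?B \<partial>?B \<partial>?A \<partial>?A)"
    by (rule nn_integral_cong, rule AB.Fubini') measurable
  also have "\<dots> = (\<integral>\<^sup>+c. \<integral>\<^sup>+a. \<integral>\<^sup>+b. \<integral>\<^sup>+d. f (?mg (c, b), ?mg (a, d)) \<partial>?B \<partial>?B \<partial>?A \<partial>?A)"
    by (rule AA.Fubini') measurable
  also have "\<dots> = (\<integral>\<^sup>+c. \<integral>\<^sup>+b. \<integral>\<^sup>+a. \<integral>\<^sup>+d. f (?mg (c, b), ?mg (a, d)) \<partial>?B \<partial>?A \<partial>?B \<partial>?A)"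
    by (rule nn_integral_cong, rule BA.Fubini') measurable
  also have "\<dots> = (\<integral>\<^sup>+z. f z \<partial>(?m \<Otimes>\<^sub>M ?m))"
    by (rule split[symmetric]) measurable
  finally show ?thesis .
qed

lemma distr_swap_coords:
  assumes S: "S \<subseteq> I"
  shows "distr (PiM I M \<Otimes>\<^sub>M PiM I M) (PiM I M \<Otimes>\<^sub>M PiM I M) (swap_coords S) = PiM I M \<Otimes>\<^sub>M PiM I M"
    (is "distr ?mm ?mm _ = _")
proof (rule measure_eqI)
  note [measurable] = measurable_swap_coords[OF S, where M = M]
  fix X assume "X \<in> sets (distr ?mm ?mm (swap_coords S))"
  then have X[measurable]: "X \<in> sets ?mm" by simp
  have "emeasure (distr ?mm ?mm (swap_coords S)) X =
      (\<integral>\<^sup>+z. indicator X z \<partial>distr ?mm ?mm (swap_coords S))"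
    by simp
  also have "\<dots> = (\<integral>\<^sup>+z. indicator X (swap_coords S z) \<partial>?mm)"
    by (rule nn_integral_distr) measurable
  also have "\<dots> = (\<integral>\<^sup>+z. indicator X z \<partial>?mm)"
    by (rule nn_integral_swap_coords[OF S]) measurable
  finally show "emeasure (distr ?mm ?mm (swap_coords S)) X = emeasure ?mm X" by simp
qed simp

lemma AE_swap_coords:
  assumes S: "S \<subseteq> I" and "AE z in PiM I M \<Otimes>\<^sub>M PiM I M. Q z"
  shows "AE z in PiM I M \<Otimes>\<^sub>M PiM I M. Q (swap_coords S z)"
  by (rule AE_distrD[OF measurable_swap_coords[OF S]])
    (simp only: distr_swap_coords[OF S] assms(2))

lemma integral_swap_coords:
  fixes f :: "_ \<Rightarrow> real"
  assumes S: "S \<subseteq> I" and f: "f \<in> borel_measurable (PiM I M \<Otimes>\<^sub>M PiM I M)"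
  shows "(\<integral>z. f (swap_coords S z) \<partial>(PiM I M \<Otimes>\<^sub>M PiM I M)) = (\<integral>z. f z \<partial>(PiM I M \<Otimes>\<^sub>M PiM I M))"
  using integral_distr[OF measurable_swap_coords[OF S] f] by (simp add: distr_swap_coords[OF S])

end

section \<open>Entropy minimality makes a density invariant under exchanges\<close>

context
  fixes M :: "'i \<Rightarrow> 'b measure" and I :: "'i set"
  assumes prob: "\<And>i. prob_space (M i)" and fin_I: "finite I"
begin

text \<open>The quantitative core of the exchange argument. The measure with density \<open>g\<close> relative to the
  reference \<open>r m\<close>, with \<open>m\<close> the product measure, is assumed to be minimal for the entropy among
  bounded perturbations that live where \<open>r\<close> and \<open>g\<close> are bounded and keep its
  one-dimensional marginals. The bounds by \<open>N\<close> and the gap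
  \<open>1/N\<close> are there so that one single perturbation size works on the whole set of bad pairs, and
  no limit has to be taken. At the receiving points \<open>fst z, snd z\<close> the value \<open>g = 0\<close> is allowed,
  since mass is only added there.\<close>

lemma swap_gain_null:
  fixes r g :: "('i \<Rightarrow> 'b) \<Rightarrow> real" and N :: real
  assumes S: "S \<subseteq> I"
    and [measurable]: "r \<in> borel_measurable (PiM I M)" "g \<in> borel_measurable (PiM I M)"
    and r: "\<And>x. 0 < r x" and g: "\<And>x. 0 \<le> g x" and N: "1 \<le> N"
    and opt: "\<And>k C. k \<in> borel_measurable (PiM I M) \<Longrightarrow>
        (\<And>x. \<bar>k x\<bar> \<le> C) \<Longrightarrow> (\<And>x. k x \<noteq> 0 \<Longrightarrow> r x \<le> C \<and> g x \<le> C) \<Longrightarrow> (\<And>x. 0 \<le> g x + k x) \<Longrightarrow>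
        (\<And>i A. i \<in> I \<Longrightarrow> A \<in> sets (M i) \<Longrightarrow>
           (\<integral>x. indicator A (x i) * (k x * r x) \<partial>PiM I M) = 0) \<Longrightarrow>
        integrable (PiM I M) (\<lambda>x. ((g x + k x) * ln (g x + k x) - g x * ln (g x)) * r x) \<and>
        0 \<le> (\<integral>x. ((g x + k x) * ln (g x + k x) - g x * ln (g x)) * r x \<partial>PiM I M)"
  shows "AE z in PiM I M \<Otimes>\<^sub>M PiM I M.
    \<not> ((\<forall>x\<in>{fst z, snd z}. (g x = 0 \<or> 1/N \<le> g x) \<and> g x \<le> N \<and> 1/N \<le> r x \<and> r x \<le> N) \<and>
       (\<forall>x\<in>{fst (swap_coords S z), snd (swap_coords S z)}. 1/N \<le> g x \<and> g x \<le> N \<and> 1/N \<le> r x \<and> r x \<le> N) \<and>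
       g (fst z) * g (snd z) + 1/N \<le> g (fst (swap_coords S z)) * g (snd (swap_coords S z)))"
proof -
  let ?m = "PiM I M" and ?P = "swap_coords S"
  let ?mm = "?m \<Otimes>\<^sub>M ?m"
  note [measurable] = measurable_swap_coords[OF S, where M = M]
  interpret m: prob_space ?m by (rule prob_space_PiM) (rule prob)
  interpret mm: pair_prob_space ?m ?m ..
  define E where "E x \<longleftrightarrow> 1/N \<le> g x \<and> g x \<le> N \<and> 1/N \<le> r x \<and> r x \<le> N" for x
  define E0 where "E0 x \<longleftrightarrow> (g x = 0 \<or> 1/N \<le> g x) \<and> g x \<le> N \<and> 1/N \<le> r x \<and> r x \<le> N" for x
  define B where "B z \<longleftrightarrow> E0 (fst z) \<and> E0 (snd z) \<and> E (fst (?P z)) \<and> E (snd (?P z)) \<and>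
      g (fst z) * g (snd z) + 1/N \<le> g (fst (?P z)) * g (snd (?P z))" for z
  define b :: "_ \<Rightarrow> real" where "b z = of_bool (B z)" for z
  have [measurable]: "Measurable.pred ?m E" "Measurable.pred ?m E0"
    unfolding E_def[abs_def] E0_def[abs_def] by measurable
  have [measurable]: "Measurable.pred ?mm B"
    unfolding B_def[abs_def] by measurable
  have bm[measurable]: "b \<in> borel_measurable ?mm"
    unfolding b_def[abs_def] by measurable
  have b01: "0 \<le> b z" "b z \<le> 1" "norm (b z) \<le> 1" for z by (simp_all add: b_def)
  \<comment> \<open>\<open>p\<close> is the density of the mass received at the first point of a bad pair, \<open>q\<close> of the mass given
    away at the first point of an exchanged bad pair; by symmetry of \<open>B\<close> the second points behave
    alike.\<close>
  define p where "p x = (\<integral>y. b (x, y) \<partial>?m)" for x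
  define q where "q x = (\<integral>y. b (?P (x, y)) \<partial>?m)" for x
  have [measurable]: "p \<in> borel_measurable ?m" "q \<in> borel_measurable ?m"
    unfolding p_def[abs_def] q_def[abs_def] by measurable
  have ible: "integrable ?m (\<lambda>y. b (x, y))" "integrable ?m (\<lambda>y. b (?P (x, y)))"
    if "x \<in> space ?m" for x
    by (rule m.integrable_const_bound[where B = 1]; use that in \<open>simp add: b01 del: real_norm_def\<close>)+
  have pq01: "0 \<le> p x" "p x \<le> 1" "0 \<le> q x" "q x \<le> 1" if "x \<in> space ?m" for x
    unfolding p_def q_def
    by (rule integral_nonneg_AE m.integral_le_const | rule AE_I2 | rule b01 | rule ible[OF that])+
  have pE0: "E0 x" if "p x \<noteq> 0" for x
  proof (rule ccontr)
    assume "\<not> E0 x"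
    then have "b (x, y) = 0" for y by (simp add: b_def B_def)
    with that show False by (simp add: p_def)
  qed
  have qE: "E x" if "q x \<noteq> 0" for x
  proof (rule ccontr)
    assume "\<not> E x"
    then have "b (?P (x, y)) = 0" for y by (simp add: b_def B_def swap_coords_involution)
    with that show False by (simp add: q_def)
  qed
  have EE0: "E x \<Longrightarrow> E0 x" for x by (simp add: E_def E0_def)
  have mmI: "integrable ?mm (\<lambda>z. b z * c z)"
    if c[measurable]: "c \<in> borel_measurable ?mm" and "\<And>z. \<bar>c z\<bar> \<le> C" for c C
  proof (rule mm.integrable_const_bound[where B = C])
    have "\<bar>b z * c z\<bar> \<le> 1 * C" for z
      unfolding abs_mult using b01[of z] that(2)[of z] by (intro mult_mono) auto
    then show "AE z in ?mm. norm (b z * c z) \<le> C" by simp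
  qed measurable
  have int_p: "(\<integral>x. c x * p x \<partial>?m) = (\<integral>z. b z * c (fst z) \<partial>?mm)"
    if c[measurable]: "c \<in> borel_measurable ?m" and bd: "\<And>x. \<bar>c x\<bar> \<le> C" for c C
  proof -
    have "(\<integral>z. b z * c (fst z) \<partial>?mm) = (\<integral>x. \<integral>y. b (x, y) * c x \<partial>?m \<partial>?m)"
      by (subst mm.integral_fst'[symmetric]) (auto intro!: mmI bd)
    then show ?thesis by (simp add: p_def mult.commute)
  qed
  have int_q: "(\<integral>x. c x * q x \<partial>?m) = (\<integral>z. b z * c (fst (?P z)) \<partial>?mm)"
    if c[measurable]: "c \<in> borel_measurable ?m" and bd: "\<And>x. \<bar>c x\<bar> \<le> C" for c C
  proof -
    have ig: "integrable ?mm (\<lambda>z. b (?P z) * c (fst z))"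
    proof (rule mm.integrable_const_bound[where B = C])
      have "\<bar>b (?P z) * c (fst z)\<bar> \<le> 1 * C" for z
        unfolding abs_mult using b01[of "?P z"] bd[of "fst z"] by (intro mult_mono) auto
      then show "AE z in ?mm. norm (b (?P z) * c (fst z)) \<le> C" by simp
    qed measurable
    have "(\<integral>z. b (?P z) * c (fst z) \<partial>?mm) = (\<integral>x. \<integral>y. b (?P (x, y)) * c x \<partial>?m \<partial>?m)"
      by (subst mm.integral_fst'[OF ig, symmetric]) simp
    also have "\<dots> = (\<integral>x. c x * q x \<partial>?m)" by (simp add: q_def mult.commute)
    also have "(\<integral>z. b (?P z) * c (fst z) \<partial>?mm) = (\<integral>z. b (?P z) * c (fst (?P (?P z))) \<partial>?mm)"
      by (simp add: swap_coords_involution)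
    also have "\<dots> = (\<integral>z. b z * c (fst (?P z)) \<partial>?mm)"
      using integral_swap_coords[OF prob fin_I S, of "\<lambda>z. b z * c (fst (?P z))"] by simp
    finally show ?thesis by simp
  qed
  have Psym: "?P (y, x) = (snd (?P (x, y)), fst (?P (x, y)))" for x y
    by (simp add: swap_coords_def)
  have Bsym: "B (y, x) = B (x, y)" for x y
    unfolding B_def Psym[of y x] by (auto simp: mult.commute)
  have Psym': "fst (?P (snd z, fst z)) = snd (?P z)" for z
    by (simp add: swap_coords_def)
  have int_sym: "(\<integral>z. b z * c z \<partial>?mm) = (\<integral>z. b z * c (snd z, fst z) \<partial>?mm)"
    if [measurable]: "c \<in> borel_measurable ?mm" for c :: "_ \<Rightarrow> real"
  proof -
    have "(\<integral>z. b z * c z \<partial>?mm) = (\<integral>(x, y). b (y, x) * c (y, x) \<partial>?mm)"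
      by (rule mm.integral_product_swap[symmetric]) measurable
    also have "\<dots> = (\<integral>z. b z * c (snd z, fst z) \<partial>?mm)"
      by (rule Bochner_Integration.integral_cong) (auto simp: b_def Bsym)
    finally show ?thesis .
  qed

  \<comment> \<open>\<open>d\<close> bounds the perturbation of \<open>g\<close>. It is small enough that \<open>g\<close> stays at least \<open>d\<close> where mass is
    taken away, and that a change by \<open>d\<close> in all four values of \<open>g\<close> does not close the gap \<open>1/N\<close>.\<close>
  define d where "d = 1 / (8 * N^2)"
  define e where "e = d / N"
  have N0: "0 < N" using N by simp
  have d0: "0 < d" and e0: "0 < e" using N0 by (simp_all add: d_def e_def)
  have dN: "2 * d \<le> 1/N" using N by (simp add: d_def power2_eq_square field_simps)
  have "1/N \<le> 1" using N by simp
  then have d1: "d \<le> 1" using dN d0 by linarith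
  have dgap: "4 * N * d + d * d < 1/N"
  proof -
    have "4 * N * d = 1 / (2 * N)" using N0 by (simp add: d_def power2_eq_square)
    moreover have "d * d \<le> 1 / (8 * N)"
    proof -
      have "d * d \<le> d * 1" using d0 d1 by (intro mult_left_mono) auto
      also have "d * 1 \<le> 1 / (8 * N)" using N by (simp add: d_def power2_eq_square field_simps)
      finally show ?thesis .
    qed
    moreover have "1 / (2 * N) + 1 / (8 * N) < 1 / N" using N0 by (simp add: field_simps)
    ultimately show ?thesis by linarith
  qed

  define k where "k x = (if x \<in> space ?m then e * (p x - q x) / r x else 0)" for x
  have km[measurable]: "k \<in> borel_measurable ?m"
    unfolding k_def[abs_def] by measurable
  have kr: "k x * r x = e * (p x - q x)" if "x \<in> space ?m" for x
    using that r[of x] by (simp add: k_def)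
  have k_supp: "E0 x \<and> x \<in> space ?m" if "k x \<noteq> 0" for x
    using that pE0[of x] EE0[OF qE[of x]] by (cases "q x = 0") (auto simp: k_def split: if_splits)
  have k_bound: "\<bar>k x\<bar> \<le> d" for x
  proof (cases "k x = 0")
    case False
    then have x: "E0 x" "x \<in> space ?m" using k_supp by auto
    have "\<bar>k x\<bar> = e * \<bar>p x - q x\<bar> / r x"
      using x r[of x] e0 by (simp add: k_def abs_mult)
    also have "\<dots> \<le> e * 1 / (1/N)"
      using x pq01[OF x(2)] e0 N0 by (intro frac_le mult_mono) (auto simp: E0_def)
    also have "\<dots> = d" using N0 by (simp add: e_def)
    finally show ?thesis .
  qed (use d0 in simp)
  have k_pos: "0 \<le> g x + k x" for x
  proof (cases "k x < 0")
    case True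
    then have "E0 x" "x \<in> space ?m" using k_supp[of x] by auto
    moreover have "q x \<noteq> 0"
      using True pq01[of x] r[of x] e0 \<open>x \<in> space ?m\<close>
      by (auto simp: k_def divide_less_0_iff mult_less_0_iff)
    ultimately have "1/N \<le> g x" using qE[of x] by (simp add: E_def)
    then show ?thesis using k_bound[of x] dN d0 by linarith
  qed (use g[of x] in simp)
  have k_marg: "(\<integral>x. indicator A (x i) * (k x * r x) \<partial>?m) = 0"
    if i: "i \<in> I" and A[measurable]: "A \<in> sets (M i)" for i A
  proof -
    define c :: "_ \<Rightarrow> real" where "c x = indicator A (x i)" for x :: "'i \<Rightarrow> 'b"
    have [measurable]: "(\<lambda>x. x i) \<in> measurable ?m (M i)" using i by simp
    have [measurable]: "c \<in> borel_measurable ?m"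
      unfolding c_def[abs_def] by measurable
    have c1: "\<bar>c x\<bar> \<le> 1" for x by (simp add: c_def)
    have int1: "integrable ?m (\<lambda>x. c x * p x)" "integrable ?m (\<lambda>x. c x * q x)"
      using pq01 by (auto intro!: m.integrable_const_bound[where B = 1] AE_I2 simp: c_def indicator_def abs_mult)
    have "(\<integral>x. indicator A (x i) * (k x * r x) \<partial>?m) = (\<integral>x. e * (c x * p x - c x * q x) \<partial>?m)"
      by (intro Bochner_Integration.integral_cong) (simp_all add: kr c_def algebra_simps)
    also have "\<dots> = e * ((\<integral>x. c x * p x \<partial>?m) - (\<integral>x. c x * q x \<partial>?m))"
      using int1 by simp
    also have "(\<integral>x. c x * p x \<partial>?m) = (\<integral>z. b z * c (fst z) \<partial>?mm)"
      by (rule int_p[OF _ c1]) measurable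
    also have "(\<integral>x. c x * q x \<partial>?m) = (\<integral>z. b z * c (fst (?P z)) \<partial>?mm)"
      by (rule int_q[OF _ c1]) measurable
    also have "\<dots> = (\<integral>z. b z * c (fst z) \<partial>?mm)"
    proof (cases "i \<in> S")
      case True
      then have "c (fst (?P z)) = c (snd z)" for z by (simp add: c_def swap_coords_def)
      then show ?thesis using int_sym[of "\<lambda>z. c (snd z)"] by simp
    next
      case False
      then have "c (fst (?P z)) = c (fst z)" for z by (simp add: c_def swap_coords_def)
      then show ?thesis by simp
    qed
    finally show ?thesis by simp
  qed

  \<comment> \<open>Upper and lower bounds for the logarithm of the perturbed density, truncated to be bounded
    everywhere; the truncations are inactive on the sets that matter.\<close>
  define h where "h x = ln (min (g x) N + d)" for x
  define l where "l x = ln (max (min (g x) N - d) d)" for x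
  have [measurable]: "h \<in> borel_measurable ?m" "l \<in> borel_measurable ?m"
    unfolding h_def[abs_def] l_def[abs_def] by measurable
  define C where "C = \<bar>ln d\<bar> + \<bar>ln (N + d)\<bar> + N + d + 1"
  have C: "\<bar>1 + h x\<bar> \<le> C" "\<bar>1 + l x\<bar> \<le> C" "d \<le> C" "N \<le> C" for x
  proof -
    have "ln d \<le> h x" "h x \<le> ln (N + d)"
      using d0 g[of x] N0 unfolding h_def by (auto intro!: ln_mono)
    moreover have "ln d \<le> l x" "l x \<le> ln (N + d)"
      using d0 g[of x] N0 unfolding l_def by (auto intro!: ln_mono)
    ultimately show "\<bar>1 + h x\<bar> \<le> C" "\<bar>1 + l x\<bar> \<le> C" "d \<le> C" "N \<le> C"
      using N0 d0 unfolding C_def by linarith+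
  qed
  have point: "((g x + k x) * ln (g x + k x) - g x * ln (g x)) * r x \<le>
      e * ((1 + h x) * p x - (1 + l x) * q x)" if x: "x \<in> space ?m" for x
  proof (cases "E0 x")
    case False
    then have "p x = 0" "q x = 0" using pE0[of x] qE[of x] EE0[of x] by auto
    then show ?thesis by (simp add: k_def)
  next
    case True
    then have gN: "g x \<le> N" and g0: "g x = 0 \<or> 1/N \<le> g x" by (simp_all add: E0_def)
    show ?thesis
    proof (cases "g x + k x = 0")
      case True
      \<comment> \<open>Here the convention \<open>ln 0 = 0\<close> must not matter: mass is given away only where \<open>g\<close> is positive,
        so that \<open>p x = q x = 0\<close>.\<close>
      then have "g x = 0" using g0 k_bound[of x] dN d0 by auto
      then have "k x = 0" using True by simp
      then have "p x = q x" using x r[of x] e0 by (simp add: k_def)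
      moreover have "q x = 0" using qE[of x] \<open>g x = 0\<close> N0 by (auto simp: E_def)
      ultimately show ?thesis using \<open>g x = 0\<close> \<open>k x = 0\<close> by simp
    next
      case False
      then have pos: "0 < g x + k x" using k_pos[of x] by simp
      have "((g x + k x) * ln (g x + k x) - g x * ln (g x)) * r x \<le> (k x * (1 + ln (g x + k x))) * r x"
        using mult_ln_diff_le[OF pos g[of x]] r[of x] by (intro mult_right_mono) auto
      also have "\<dots> = e * ((1 + ln (g x + k x)) * p x - (1 + ln (g x + k x)) * q x)"
      proof -
        have "k x * (1 + ln (g x + k x)) * r x = (k x * r x) * (1 + ln (g x + k x))" by simp
        then show ?thesis unfolding kr[OF x] by (simp add: algebra_simps)
      qed
      also have "\<dots> \<le> e * ((1 + h x) * p x - (1 + l x) * q x)"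
      proof (intro mult_left_mono diff_mono)
        have "ln (g x + k x) \<le> h x"
          unfolding h_def using k_bound[of x] gN pos by (intro ln_mono) auto
        then show "(1 + ln (g x + k x)) * p x \<le> (1 + h x) * p x"
          using pq01[OF x] by (intro mult_right_mono) auto
        show "(1 + l x) * q x \<le> (1 + ln (g x + k x)) * q x"
        proof (cases "q x = 0")
          case False
          then have "1/N \<le> g x" using qE by (auto simp: E_def)
          then have "l x \<le> ln (g x + k x)"
            unfolding l_def using k_bound[of x] gN pos dN d0 by (intro ln_mono) auto
          then show ?thesis using pq01[OF x] by (intro mult_right_mono) auto
        qed simp
      qed (use e0 in simp)
      finally show ?thesis .
    qed
  qed
  have ip: "integrable ?m (\<lambda>x. (1 + h x) * p x)" "integrable ?m (\<lambda>x. (1 + l x) * q x)"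
  proof -
    have bd: "\<bar>(1 + h x) * p x\<bar> \<le> C * 1" "\<bar>(1 + l x) * q x\<bar> \<le> C * 1" if "x \<in> space ?m" for x
      unfolding abs_mult by (rule mult_mono; use C(1,2)[of x] C(3) pq01[OF that] d0 in simp)+
    show "integrable ?m (\<lambda>x. (1 + h x) * p x)" "integrable ?m (\<lambda>x. (1 + l x) * q x)"
      by (rule m.integrable_const_bound[where B = C], rule AE_I2, use bd in simp, measurable)+
  qed
  have "integrable ?m (\<lambda>x. ((g x + k x) * ln (g x + k x) - g x * ln (g x)) * r x) \<and>
      0 \<le> (\<integral>x. ((g x + k x) * ln (g x + k x) - g x * ln (g x)) * r x \<partial>?m)"
  proof (rule opt[of k C])
    show "\<bar>k x\<bar> \<le> C" for x using k_bound[of x] C(3) by linarith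
    show "r x \<le> C \<and> g x \<le> C" if "k x \<noteq> 0" for x
      using k_supp[OF that] C(4) by (auto simp: E0_def intro: order_trans)
  qed (use k_pos k_marg in auto)
  then have ik: "integrable ?m (\<lambda>x. ((g x + k x) * ln (g x + k x) - g x * ln (g x)) * r x)"
    and "0 \<le> (\<integral>x. ((g x + k x) * ln (g x + k x) - g x * ln (g x)) * r x \<partial>?m)" by auto
  note this(2)
  also have "(\<integral>x. ((g x + k x) * ln (g x + k x) - g x * ln (g x)) * r x \<partial>?m) \<le>
      (\<integral>x. e * ((1 + h x) * p x - (1 + l x) * q x) \<partial>?m)"
    using ip by (intro integral_mono ik point) auto
  also have "\<dots> = e * ((\<integral>x. (1 + h x) * p x \<partial>?m) - (\<integral>x. (1 + l x) * q x \<partial>?m))"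
    using ip by simp
  finally have "0 \<le> (\<integral>x. (1 + h x) * p x \<partial>?m) - (\<integral>x. (1 + l x) * q x \<partial>?m)"
    using e0 by (simp add: zero_le_mult_iff)
  also have "(\<integral>x. (1 + h x) * p x \<partial>?m) = (\<integral>z. b z * (1 + h (fst z)) \<partial>?mm)"
    by (rule int_p[OF _ C(1)]) measurable
  also have "(\<integral>x. (1 + l x) * q x \<partial>?m) = (\<integral>z. b z * (1 + l (fst (?P z))) \<partial>?mm)"
    by (rule int_q[OF _ C(2)]) measurable
  finally have first: "0 \<le> (\<integral>z. b z * (1 + h (fst z)) \<partial>?mm) - (\<integral>z. b z * (1 + l (fst (?P z))) \<partial>?mm)" .
  have sym: "(\<integral>z. b z * (1 + h (fst z)) \<partial>?mm) = (\<integral>z. b z * (1 + h (snd z)) \<partial>?mm)"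
    "(\<integral>z. b z * (1 + l (fst (?P z))) \<partial>?mm) = (\<integral>z. b z * (1 + l (snd (?P z))) \<partial>?mm)"
    using int_sym[of "\<lambda>z. 1 + h (fst z)"] int_sym[of "\<lambda>z. 1 + l (fst (?P z))"]
    by (simp_all add: Psym')
  have int4: "integrable ?mm (\<lambda>z. b z * (1 + h (fst z)))" "integrable ?mm (\<lambda>z. b z * (1 + h (snd z)))"
    "integrable ?mm (\<lambda>z. b z * (1 + l (fst (?P z))))" "integrable ?mm (\<lambda>z. b z * (1 + l (snd (?P z))))"
    by (rule mmI[OF _ C(1)] mmI[OF _ C(2)], measurable)+
  \<comment> \<open>Its integral is twice the negative of an upper bound for the derivative of the entropy, so it is
    at most \<open>0\<close>; but the gap makes it positive on \<open>B\<close>.\<close>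
  define F where "F z = b z * (l (fst (?P z)) + l (snd (?P z)) - h (fst z) - h (snd z))" for z
  have F_eq: "F z = b z * (1 + l (fst (?P z))) + b z * (1 + l (snd (?P z))) - b z * (1 + h (fst z)) - b z * (1 + h (snd z))" for z
    by (simp add: F_def algebra_simps)
  have F_int: "integrable ?mm F"
    unfolding F_eq[abs_def] using int4 by simp
  have "(\<integral>z. F z \<partial>?mm) \<le> 0"
    unfolding F_eq using int4 sym first by simp
  have F_pos: "0 < F z" if "B z" for z
  proof -
    let ?x = "fst z" and ?y = "snd z" and ?u = "fst (?P z)" and ?v = "snd (?P z)"
    have gs: "0 \<le> g ?x" "g ?x \<le> N" "0 \<le> g ?y" "g ?y \<le> N" "1/N \<le> g ?u" "g ?u \<le> N" "1/N \<le> g ?v" "g ?v \<le> N"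
      and gap: "g ?x * g ?y + 1/N \<le> g ?u * g ?v"
      using that g by (auto simp: B_def E_def E0_def)
    have du: "0 < g ?u - d" "0 < g ?v - d" using gs dN d0 by linarith+
    have "(g ?x + d) * (g ?y + d) = g ?x * g ?y + d * (g ?x + g ?y) + d * d"
      by (simp add: algebra_simps)
    also have "\<dots> \<le> g ?x * g ?y + d * (2 * N) + d * d"
      using gs d0 by (intro add_mono mult_left_mono) auto
    also have "\<dots> < g ?u * g ?v - d * (2 * N)"
      using gap dgap by (simp add: algebra_simps)
    also have "\<dots> \<le> g ?u * g ?v - d * (g ?u + g ?v) + d * d"
      using mult_left_mono[of "g ?u + g ?v" "2 * N" d] gs d0 by (simp add: add_increasing2)
    also have "\<dots> = (g ?u - d) * (g ?v - d)" by (simp add: algebra_simps)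
    finally have "ln ((g ?x + d) * (g ?y + d)) < ln ((g ?u - d) * (g ?v - d))"
      using gs d0 du by (intro ln_less_cancel_iff[THEN iffD2]) (auto intro!: mult_pos_pos add_nonneg_pos)
    moreover have "ln ((g ?x + d) * (g ?y + d)) = h ?x + h ?y"
      using gs d0 unfolding h_def by (subst ln_mult) (auto simp: min_def add_nonneg_pos)
    moreover have "ln ((g ?u - d) * (g ?v - d)) = l ?u + l ?v"
    proof -
      have "max (min (g ?u) N - d) d = g ?u - d" "max (min (g ?v) N - d) d = g ?v - d"
        using gs dN by (simp_all add: max_def)
      then show ?thesis unfolding l_def using du by (simp add: ln_mult)
    qed
    ultimately show ?thesis using that by (simp add: F_def b_def)
  qed
  have F_nonneg: "0 \<le> F z" for z
    using F_pos[of z] by (cases "B z") (auto simp: F_def b_def)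
  have "(\<integral>z. F z \<partial>?mm) = 0"
    using \<open>(\<integral>z. F z \<partial>?mm) \<le> 0\<close> F_nonneg by (intro antisym) simp_all
  then have "AE z in ?mm. F z = 0"
    using integral_nonneg_eq_0_iff_AE[OF F_int] F_nonneg by simp
  then have "AE z in ?mm. \<not> B z"
    by eventually_elim (use F_pos in force)
  then show ?thesis
    by (rule AE_mp) (auto intro!: AE_I2 simp: B_def E_def E0_def)
qed

end

context
  fixes M :: "'i \<Rightarrow> 'b measure" and I :: "'i set"
  assumes prob: "\<And>i. prob_space (M i)" and fin_I: "finite I"
begin

text \<open>Letting the cutoff \<open>N\<close> tend to infinity excludes every pair with
  \<open>g x g y < g x' g y'\<close>; applying this to the exchanged pair reverses the inequality, because
  the exchange is a measure preserving involution.\<close>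

lemma swap_invariant_if_optimal:
  fixes r g :: "('i \<Rightarrow> 'b) \<Rightarrow> real"
  assumes S: "S \<subseteq> I"
    and [measurable]: "r \<in> borel_measurable (PiM I M)" "g \<in> borel_measurable (PiM I M)"
    and r: "\<And>x. 0 < r x" and g: "\<And>x. 0 \<le> g x"
    and opt: "\<And>k C. k \<in> borel_measurable (PiM I M) \<Longrightarrow>
        (\<And>x. \<bar>k x\<bar> \<le> C) \<Longrightarrow> (\<And>x. k x \<noteq> 0 \<Longrightarrow> r x \<le> C \<and> g x \<le> C) \<Longrightarrow> (\<And>x. 0 \<le> g x + k x) \<Longrightarrow>
        (\<And>i A. i \<in> I \<Longrightarrow> A \<in> sets (M i) \<Longrightarrow>
           (\<integral>x. indicator A (x i) * (k x * r x) \<partial>PiM I M) = 0) \<Longrightarrow>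
        integrable (PiM I M) (\<lambda>x. ((g x + k x) * ln (g x + k x) - g x * ln (g x)) * r x) \<and>
        0 \<le> (\<integral>x. ((g x + k x) * ln (g x + k x) - g x * ln (g x)) * r x \<partial>PiM I M)"
  shows "AE z in PiM I M \<Otimes>\<^sub>M PiM I M.
    g (fst z) * g (snd z) = g (fst (swap_coords S z)) * g (snd (swap_coords S z))"
proof -
  let ?P = "swap_coords S"
  have ge: "AE z in PiM I M \<Otimes>\<^sub>M PiM I M.
      g (fst (?P z)) * g (snd (?P z)) \<le> g (fst z) * g (snd z)"
  proof -
    have "AE z in PiM I M \<Otimes>\<^sub>M PiM I M. \<forall>n.
      \<not> ((\<forall>x\<in>{fst z, snd z}. (g x = 0 \<or> 1 / real (Suc n) \<le> g x) \<and> g x \<le> real (Suc n) \<and>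
            1 / real (Suc n) \<le> r x \<and> r x \<le> real (Suc n)) \<and>
         (\<forall>x\<in>{fst (?P z), snd (?P z)}. 1 / real (Suc n) \<le> g x \<and> g x \<le> real (Suc n) \<and>
            1 / real (Suc n) \<le> r x \<and> r x \<le> real (Suc n)) \<and>
         g (fst z) * g (snd z) + 1 / real (Suc n) \<le> g (fst (?P z)) * g (snd (?P z)))"
      unfolding AE_all_countable
      by (intro allI swap_gain_null[OF prob fin_I S _ _ r g _ opt]) auto
    then show ?thesis
    proof eventually_elim
      case (elim z)
      show ?case
      proof (rule ccontr)
        assume "\<not> g (fst (?P z)) * g (snd (?P z)) \<le> g (fst z) * g (snd z)"
        then have less: "g (fst z) * g (snd z) < g (fst (?P z)) * g (snd (?P z))" by simp
        then have pos: "0 < g (fst (?P z))" "0 < g (snd (?P z))"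
          using g[of "fst z"] g[of "snd z"] g[of "fst (?P z)"] g[of "snd (?P z)"]
          by (smt (verit) mult_nonneg_nonneg mult_eq_0_iff)+
        have small: "\<forall>\<^sub>F n in sequentially. 1 / real (Suc n) < c" if "0 < c" for c
          using order_tendstoD(2)[OF LIMSEQ_Suc[OF lim_1_over_n] that] by simp
        have big: "\<forall>\<^sub>F n in sequentially. c < real (Suc n)" for c
          using filterlim_at_top_dense[THEN iffD1, OF filterlim_compose[OF filterlim_real_sequentially filterlim_Suc]]
          by blast
        have sg: "\<forall>\<^sub>F n in sequentially. g x = 0 \<or> 1 / real (Suc n) < g x" for x
          using small[of "g x"] g[of x] by (cases "g x = 0") auto
        have "\<forall>\<^sub>F n in sequentially. False"
          using small[OF r[of "fst z"]] small[OF r[of "snd z"]] small[OF r[of "fst (?P z)"]]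
            small[OF r[of "snd (?P z)"]] big[of "r (fst z)"] big[of "r (snd z)"]
            big[of "r (fst (?P z))"] big[of "r (snd (?P z))"]
            big[of "g (fst z)"] big[of "g (snd z)"]
            big[of "g (fst (?P z))"] big[of "g (snd (?P z))"]
            small[OF pos(1)] small[OF pos(2)] sg[of "fst z"] sg[of "snd z"]
            small[OF diff_gt_0_iff_gt[THEN iffD2, OF less]]
        proof eventually_elim
          case (elim n)
          then have "(\<forall>x\<in>{fst z, snd z}. (g x = 0 \<or> 1 / real (Suc n) \<le> g x) \<and> g x \<le> real (Suc n) \<and>
              1 / real (Suc n) \<le> r x \<and> r x \<le> real (Suc n)) \<and>
           (\<forall>x\<in>{fst (?P z), snd (?P z)}. 1 / real (Suc n) \<le> g x \<and> g x \<le> real (Suc n) \<and>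
              1 / real (Suc n) \<le> r x \<and> r x \<le> real (Suc n)) \<and>
           g (fst z) * g (snd z) + 1 / real (Suc n) \<le> g (fst (?P z)) * g (snd (?P z))"
            by (auto simp only: ball_simps insert_iff empty_iff intro: less_imp_le)
          with \<open>\<forall>n. \<not> _ n\<close> show False by blast
        qed
        then show False by simp
      qed
    qed
  qed
  from ge AE_swap_coords[OF prob fin_I S ge] show ?thesis
    by eventually_elim (simp add: swap_coords_involution)
qed

text \<open>A point assembled from coordinates of two independent generic points is generic.\<close>

lemma AE_override_on:
  assumes "S \<subseteq> I" and Q: "AE z in PiM I M. Q z"
  shows "AE b in PiM I M. AE x in PiM I M. Q (override_on x b S)"
proof -
  let ?m = "PiM I M"
  interpret m: prob_space ?m by (rule prob_space_PiM) (rule prob)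
  interpret mm: pair_prob_space ?m ?m ..
  have "AE z in ?m \<Otimes>\<^sub>M ?m. Q (snd z)"
  proof -
    have "distr (?m \<Otimes>\<^sub>M ?m) ?m snd = ?m"
      by (rule measure_eqI)
        (auto simp: emeasure_distr m.emeasure_pair_measure_Times m.emeasure_space_1
          space_pair_measure snd_vimage_eq_Times sets.sets_into_space Times_Int_Times Int_absorb2
          intro!: arg_cong2[where f = "(*)"] dest: sets.sets_into_space)
    then show ?thesis
      by (intro AE_distrD[OF measurable_snd[of ?m ?m]]) (simp only: Q)
  qed
  from AE_swap_coords[OF prob fin_I assms(1) this]
  have "AE z in ?m \<Otimes>\<^sub>M ?m. Q (override_on (snd z) (fst z) S)"
    by (simp add: swap_coords_def)
  then show ?thesis by (rule mm.AE_pair[THEN AE_mp]) auto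
qed

text \<open>Fixing a generic \<open>a\<close> with \<open>g a \<noteq> 0\<close>, the invariance reads \<open>g x = f j (x j) * c j x\<close> with
  \<open>c j x\<close> independent of \<open>x j\<close>. The same base point cannot be inserted repeatedly, since a point
  that already shares coordinates with \<open>a\<close> is not generic relative to \<open>a\<close>. So the induction
  over the coordinates that are already split off carries an arbitrary remainder \<open>\<gamma>\<close> that is
  independent of these coordinates, and compares the two factorizations at a new generic point.\<close>

lemma swap_invariant_factorization:
  fixes g :: "('i \<Rightarrow> 'b) \<Rightarrow> real"
  assumes gm[measurable]: "g \<in> borel_measurable (PiM I M)" and g: "\<And>x. 0 \<le> g x"
    and ne: "I \<noteq> {}"
    and swap: "\<And>j. j \<in> I \<Longrightarrow> AE z in PiM I M \<Otimes>\<^sub>M PiM I M.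
      g (fst z) * g (snd z) = g (fst (swap_coords {j} z)) * g (snd (swap_coords {j} z))"
  obtains f :: "'i \<Rightarrow> 'b \<Rightarrow> real"
  where "\<And>i. i \<in> I \<Longrightarrow> f i \<in> borel_measurable (M i)" "\<And>i x. 0 \<le> f i x"
    "AE x in PiM I M. g x = (\<Prod>i\<in>I. f i (x i))"
proof (cases "AE x in PiM I M. g x = 0")
  case True
  show thesis
  proof (rule that[of "\<lambda>_ _. 0"])
    show "AE x in PiM I M. g x = (\<Prod>i\<in>I. 0)"
      using True ne fin_I by (simp add: power_0_left card_eq_0_iff)
  qed auto
next
  case False
  let ?m = "PiM I M"
  interpret m: prob_space ?m by (rule prob_space_PiM) (rule prob)
  interpret mm: pair_prob_space ?m ?m ..
  have ex: "\<exists>x\<in>space ?m. Q x \<and> g x \<noteq> 0" if "AE x in ?m. Q x" for Q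
  proof (rule ccontr)
    assume "\<not> ?thesis"
    then have "\<forall>x\<in>space ?m. Q x \<longrightarrow> g x = 0" by blast
    with that have "AE x in ?m. g x = 0" by (auto elim: AE_mp)
    with False show False by simp
  qed
  have "AE a in ?m. \<forall>j\<in>I. AE x in ?m.
      g a * g x = g (override_on a x {j}) * g (override_on x a {j})"
    using mm.AE_pair[OF swap] by (simp add: AE_finite_all[OF fin_I] swap_coords_def)
  from ex[OF this] obtain a where a: "a \<in> space ?m" "g a \<noteq> 0"
    and ax: "\<And>j. j \<in> I \<Longrightarrow> AE x in ?m. g a * g x = g (override_on a x {j}) * g (override_on x a {j})"
    by blast
  define f where "f j z = g (a(j := z))" for j z
  define c where "c j x = g (override_on x a {j}) / g a" for j x
  have f_nn: "0 \<le> f j z" for j z by (simp add: f_def g)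
  have fm: "f j \<in> borel_measurable (M j)" if "j \<in> I" for j
  proof -
    have "(\<lambda>z. a(j := z)) \<in> measurable (M j) (PiM I M)"
    proof (rule measurable_PiM_single')
      fix i assume "i \<in> I"
      then have "a i \<in> space (M i)" using a(1) by (auto simp: space_PiM)
      then have "(\<lambda>z. a i) \<in> measurable (M j) (M i)" by (rule measurable_const)
      then show "(\<lambda>z. (a(j := z)) i) \<in> measurable (M j) (M i)"
        by (cases "i = j") simp_all
    next
      show "(\<lambda>z. a(j := z)) \<in> space (M j) \<rightarrow> (\<Pi>\<^sub>E i\<in>I. space (M i))"
        using a(1) that by (auto simp: space_PiM PiE_iff extensional_def)
    qed
    then show ?thesis unfolding f_def[abs_def] by measurable
  qed
  have one: "AE x in ?m. g x = f j (x j) * c j x" if "j \<in> I" for j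
    using ax[OF that]
  proof eventually_elim
    case (elim x)
    have "override_on a x {j} = a(j := x j)" by (auto simp: override_on_def)
    with elim show ?case using a(2) by (simp add: f_def c_def field_simps)
  qed
  have "\<exists>\<gamma>. \<gamma> \<in> borel_measurable ?m \<and> (\<forall>x. 0 \<le> \<gamma> x) \<and>
      (\<forall>x y. (\<forall>i. i \<notin> S \<longrightarrow> x i = y i) \<longrightarrow> \<gamma> x = \<gamma> y) \<and>
      (AE x in ?m. g x = (\<Prod>i\<in>S. f i (x i)) * \<gamma> x)" if "S \<subseteq> I" for S
    using finite_subset[OF that fin_I] that
  proof (induction S rule: finite_induct)
    case empty
    show ?case by (intro exI[of _ g]) (auto simp: g intro: arg_cong[where f = g])
  next
    case (insert j S)
    then obtain \<gamma> where \<gamma>: "\<gamma> \<in> borel_measurable ?m" "\<And>x. 0 \<le> \<gamma> x"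
        "\<And>x y. (\<forall>i. i \<notin> S \<longrightarrow> x i = y i) \<Longrightarrow> \<gamma> x = \<gamma> y"
        "AE x in ?m. g x = (\<Prod>i\<in>S. f i (x i)) * \<gamma> x" by auto
    have S: "S \<subseteq> I" "j \<in> I" using insert.prems by auto
    have both: "AE b in ?m. AE x in ?m. g (override_on x b S) = (\<Prod>i\<in>S. f i (override_on x b S i)) * \<gamma> (override_on x b S) \<and>
        g (override_on x b S) = f j (override_on x b S j) * c j (override_on x b S)"
      by (rule AE_override_on[OF S(1), where Q = "\<lambda>x. g x = (\<Prod>i\<in>S. f i (x i)) * \<gamma> x \<and> g x = f j (x j) * c j x"])
        (use one[OF S(2)] \<gamma>(4) in \<open>eventually_elim, simp\<close>)
    have e1: "(\<Prod>i\<in>S. f i (override_on x b S i)) = (\<Prod>i\<in>S. f i (b i))" for x b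
      by (rule prod.cong) (auto simp: override_on_def)
    have e2: "\<gamma> (override_on x b S) = \<gamma> x" for x b
      by (rule \<gamma>(3)) (auto simp: override_on_def)
    have e3: "override_on x b S j = x j" for x b
      using insert.hyps by (auto simp: override_on_def)
    have "AE b in ?m. AE x in ?m.
        (\<Prod>i\<in>S. f i (b i)) * \<gamma> x = f j (x j) * c j (override_on x b S)"
    proof (rule eventually_mono[OF both])
      fix b
      assume "AE x in ?m. g (override_on x b S) = (\<Prod>i\<in>S. f i (override_on x b S i)) * \<gamma> (override_on x b S) \<and>
        g (override_on x b S) = f j (override_on x b S j) * c j (override_on x b S)"
      then show "AE x in ?m. (\<Prod>i\<in>S. f i (b i)) * \<gamma> x = f j (x j) * c j (override_on x b S)"
        unfolding e1 e2 e3 by (rule eventually_mono) simp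
    qed
    from ex[OF AE_conjI[OF this \<gamma>(4)]] obtain b where b: "b \<in> space ?m"
      and bx: "AE x in ?m. (\<Prod>i\<in>S. f i (b i)) * \<gamma> x = f j (x j) * c j (override_on x b S)"
      and Dne: "(\<Prod>i\<in>S. f i (b i)) \<noteq> 0" by auto
    define D where "D = (\<Prod>i\<in>S. f i (b i))"
    have D: "0 < D" using Dne f_nn unfolding D_def by (simp add: prod_nonneg order_less_le)
    define \<gamma>' where "\<gamma>' x = c j (override_on x b S) / D" for x
    have [measurable]: "(\<lambda>x. override_on x b S) \<in> measurable ?m ?m"
      "(\<lambda>x. override_on x a {j}) \<in> measurable ?m ?m"
      using b a(1) S by (auto intro!: measurable_override_on)
    have "\<gamma>' \<in> borel_measurable ?m"
      unfolding \<gamma>'_def[abs_def] c_def[abs_def] by measurable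
    moreover have "0 \<le> \<gamma>' x" for x
      using D g a(2) by (auto simp: \<gamma>'_def c_def)
    moreover have "\<gamma>' x = \<gamma>' y" if "\<forall>i. i \<notin> insert j S \<longrightarrow> x i = y i" for x y
    proof -
      have "override_on (override_on x b S) a {j} = override_on (override_on y b S) a {j}"
        using that by (auto simp: override_on_def fun_eq_iff)
      then show ?thesis by (simp add: \<gamma>'_def c_def)
    qed
    moreover have "AE x in ?m. g x = (\<Prod>i\<in>insert j S. f i (x i)) * \<gamma>' x"
      using \<gamma>(4) bx
    proof eventually_elim
      case (elim x)
      then have "\<gamma> x = f j (x j) * \<gamma>' x"
        using D by (simp add: \<gamma>'_def D_def field_simps)
      with elim insert.hyps show ?case by (simp add: mult_ac)
    qed
    ultimately show ?case by (intro exI[of _ \<gamma>']) blast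
  qed
  from this[OF order_refl] obtain \<gamma> where \<gamma>: "\<And>x. 0 \<le> \<gamma> x"
      "\<And>x y. (\<forall>i. i \<notin> I \<longrightarrow> x i = y i) \<Longrightarrow> \<gamma> x = \<gamma> y"
      "AE x in ?m. g x = (\<Prod>i\<in>I. f i (x i)) * \<gamma> x" by auto
  obtain i0 where i0: "i0 \<in> I" using ne by auto
  have const: "\<gamma> x = \<gamma> a" if "x \<in> space ?m" for x
    using that a(1) by (intro \<gamma>(2)) (auto simp: space_PiM PiE_iff extensional_def)
  \<comment> \<open>The remainder is now constant; it is absorbed into one of the factors.\<close>
  define f' where "f' i z = (if i = i0 then f i z * \<gamma> a else f i z)" for i z
  show thesis
  proof (rule that[of f'])
    show "f' i \<in> borel_measurable (M i)" if "i \<in> I" for i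
      using fm[OF that] unfolding f'_def[abs_def] by (cases "i = i0") auto
    show "0 \<le> f' i x" for i x using f_nn \<gamma>(1) by (simp add: f'_def)
    have "(\<Prod>i\<in>I. f' i (x i)) = (\<Prod>i\<in>I. f i (x i)) * \<gamma> a" for x
      using i0 fin_I by (simp add: f'_def prod.remove[of I i0] mult_ac)
    with \<gamma>(3) const show "AE x in ?m. g x = (\<Prod>i\<in>I. f' i (x i))"
      by (auto elim!: AE_mp intro!: AE_I2)
  qed
qed

end

section \<open>Evaluations on path space\<close>

lemma space_path_borel [simp]: "space path_borel = paths"
  unfolding path_borel_def
  by (rule space_measure_of) (auto dest!: openin_subset simp: topspace_mtopology_of)

text \<open>Evaluation is continuous, as the supremum distance dominates the distance at time \<open>t\<close>.\<close>

lemma measurable_canonical [measurable (raw)]: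
  assumes "t \<in> {0..1}"
  shows "(\<lambda>\<omega>. \<omega> t) \<in> measurable path_borel (borel :: 'a::polish_space measure)"
proof (rule borel_measurableI)
  fix S :: "'a set" assume S: "open S"
  interpret Metric_space "paths :: (real \<Rightarrow> 'a) set" "mdist path_metric"
    by (rule Metric_space_mspace_mdist)
  have "openin (mtopology_of path_metric) ((\<lambda>\<omega>. \<omega> t) -` S \<inter> paths)"
    unfolding mtopology_of_def openin_mtopology
  proof (intro conjI allI impI)
    fix \<omega> :: "real \<Rightarrow> 'a" assume \<omega>: "\<omega> \<in> (\<lambda>\<omega>. \<omega> t) -` S \<inter> paths"
    then obtain e where e: "0 < e" "ball (\<omega> t) e \<subseteq> S"
      using S by (auto simp: open_contains_ball)
    have "mball \<omega> e \<subseteq> (\<lambda>\<omega>. \<omega> t) -` S \<inter> paths"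
    proof
      fix \<eta> assume "\<eta> \<in> mball \<omega> e"
      then have \<eta>: "\<eta> \<in> paths" "\<omega> \<in> paths" "mdist path_metric \<omega> \<eta> < e" by auto
      have "mdist euclidean_metric (\<omega> t) (\<eta> t) \<le> mdist path_metric \<omega> \<eta>"
        using \<eta> assms unfolding path_metric_def
        by (intro mdist_cfunspace_imp_mdist_le[OF _ _ order_refl]) auto
      then have "dist (\<omega> t) (\<eta> t) < e" using \<eta>(3) by simp
      then show "\<eta> \<in> (\<lambda>\<omega>. \<omega> t) -` S \<inter> paths" using e(2) \<eta>(1) by auto
    qed
    with e(1) show "\<exists>r>0. mball \<omega> r \<subseteq> (\<lambda>\<omega>. \<omega> t) -` S \<inter> paths" by blast
  qed auto
  then show "(\<lambda>\<omega>. \<omega> t) -` S \<inter> space path_borel \<in> sets path_borel"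
    unfolding space_path_borel unfolding path_borel_def
    by (subst sets_measure_of)
      (auto dest!: openin_subset simp: topspace_mtopology_of intro!: sigma_sets.Basic)
qed

lemma measurable_restrict_path [measurable]:
  assumes "S \<subseteq> {0..1}"
  shows "(\<lambda>\<omega>. restrict \<omega> S) \<in> measurable path_borel (\<Pi>\<^sub>M t\<in>S. (borel :: 'a::polish_space measure))"
  using assms by (intro measurable_restrict measurable_canonical) auto

lemma space_path_sigma [simp]: "space (path_sigma S) = paths"
  by (simp add: path_sigma_def)

lemma measurable_restrict_path_sigma:
  "(\<lambda>\<omega>. restrict \<omega> S) \<in> measurable (path_sigma S) (\<Pi>\<^sub>M t\<in>S. (borel :: 'a::polish_space measure))"
  unfolding path_sigma_def by (rule measurable_vimage_algebra1) (auto simp: space_PiM)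

lemma measurable_canonical_path_sigma:
  assumes "s \<in> S"
  shows "(\<lambda>\<omega>. \<omega> s) \<in> measurable (path_sigma S) (borel :: 'a::polish_space measure)"
  using measurable_compose[OF measurable_restrict_path_sigma measurable_component_singleton[OF assms]]
    assms by simp

lemma sets_path_sigma_le:
  assumes "S \<subseteq> {0..1}"
  shows "sets (path_sigma S) \<subseteq> sets (path_borel :: (real \<Rightarrow> 'a::polish_space) measure)"
  unfolding path_sigma_def
proof (rule sets_image_in_sets)
  show "(\<lambda>\<omega>. restrict \<omega> S) \<in> measurable path_borel (\<Pi>\<^sub>M t\<in>S. (borel :: 'a measure))"
    by (rule measurable_restrict_path[OF assms])
qed simp

text \<open>Allows an event about the times \<open>S\<close> to be used as a past or future event in the Markov
  property.\<close>

lemma restrict_event_in_path_sigma: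
  assumes "S \<subseteq> S'" "B \<in> sets (\<Pi>\<^sub>M t\<in>S. (borel :: 'a::polish_space measure))"
  shows "{\<omega> \<in> paths. restrict \<omega> S \<in> B} \<in> sets (path_sigma S')"
proof -
  have "(\<lambda>\<omega>. restrict \<omega> S) \<in> measurable (path_sigma S') (\<Pi>\<^sub>M t\<in>S. (borel :: 'a measure))"
    using assms(1) by (intro measurable_restrict measurable_canonical_path_sigma) auto
  from measurable_sets[OF this assms(2)] show ?thesis
    by (simp add: vimage_def Int_def conj_commute)
qed

context
  fixes R :: "(real \<Rightarrow> 'a::polish_space) measure"
  assumes cond: "conditionable R"
begin

lemma sets_conditionable: "sets R = sets path_borel"
  using cond by (simp add: conditionable_def)

lemma space_conditionable: "space R = paths"
  using sets_eq_imp_space_eq[OF sets_conditionable] by simp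

lemma measurable_canonical_R:
  "t \<in> {0..1} \<Longrightarrow> (\<lambda>\<omega>. \<omega> t) \<in> measurable R (borel :: 'a measure)"
  using measurable_canonical[of t] measurable_cong_sets[OF sets_conditionable refl] by blast

lemma measurable_restrict_R:
  "S \<subseteq> {0..1} \<Longrightarrow> (\<lambda>\<omega>. restrict \<omega> S) \<in> measurable R (\<Pi>\<^sub>M t\<in>S. (borel :: 'a measure))"
  using measurable_restrict_path[of S] measurable_cong_sets[OF sets_conditionable refl] by blast

lemma sigma_finite_marginal: "t \<in> {0..1} \<Longrightarrow> sigma_finite_measure (marginal R t)"
  using cond by (simp add: conditionable_def)

lemma sigma_finite_restrict_R:
  assumes "S \<subseteq> {0..1}" "s \<in> S"
  shows "sigma_finite_measure (distr R (\<Pi>\<^sub>M t\<in>S. borel) (\<lambda>\<omega>. restrict \<omega> S))" (is "sigma_finite_measure ?D")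
proof (rule sigma_finite_measure_distr)
  have "distr ?D borel (\<lambda>x. x s) = marginal R s"
    unfolding marginal_def using assms
    by (subst distr_distr) (auto intro!: measurable_restrict_R simp: comp_def)
  then show "sigma_finite_measure (distr ?D borel (\<lambda>x. x s))"
    using sigma_finite_marginal[of s] assms by auto
  show "(\<lambda>x. x s) \<in> measurable ?D borel" using assms by simp
qed

lemma sigma_finite_R: "sigma_finite_measure R"
  by (rule sigma_finite_measure_distr[OF _ measurable_canonical_R[of 0]])
    (use sigma_finite_marginal[of 0] in \<open>auto simp: marginal_def\<close>)

text \<open>Conditional expectations given \<open>X\<^sub>t\<close> make sense although \<open>R\<close> may be unbounded, because the
  time marginal is sigma-finite.\<close>

lemma sigma_finite_subalgebra_path_sigma:
  assumes t: "t \<in> {0..1}"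
  shows "sigma_finite_subalgebra R (path_sigma {t})"
proof (rule sigma_finite_subalgebra.intro)
  show sub: "subalgebra R (path_sigma {t})"
    using sets_path_sigma_le[of "{t}"] t by (simp add: subalgebra_def space_conditionable sets_conditionable)
  let ?F = "restr_to_subalg R (path_sigma {t})"
  have m: "(\<lambda>\<omega>. \<omega> t) \<in> measurable ?F borel"
    by (rule measurable_in_subalg[OF sub]) (rule measurable_canonical_path_sigma, simp)
  have "distr ?F borel (\<lambda>\<omega>. \<omega> t) = marginal R t"
    unfolding marginal_def
  proof (rule measure_eqI)
    fix A :: "'a set" assume "A \<in> sets (distr ?F borel (\<lambda>\<omega>. \<omega> t))"
    then have A: "A \<in> sets borel" by simp
    have "(\<lambda>\<omega>. \<omega> t) -` A \<inter> paths \<in> sets (path_sigma {t})"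
      using measurable_sets[OF measurable_canonical_path_sigma[of t "{t}"] A] by simp
    then show "emeasure (distr ?F borel (\<lambda>\<omega>. \<omega> t)) A = emeasure (distr R borel (\<lambda>\<omega>. \<omega> t)) A"
      using A t by (simp add: emeasure_distr m measurable_canonical_R space_restr_to_subalg
          emeasure_restr_to_subalg[OF sub] space_conditionable)
  qed simp
  then show "sigma_finite_measure ?F"
    using sigma_finite_measure_distr[OF _ m] sigma_finite_marginal[OF t] by simp
qed

end

section \<open>Markov and irreducible: finite-dimensional laws are equivalent to product measures\<close>

text \<open>Only null sets matter for the product reference measure, and a probability measure makes all
  bounded functions integrable.\<close>

lemma equivalent_prob_measure:
  assumes "sigma_finite_measure M" "emeasure M (space M) \<noteq> 0"
  obtains N where "prob_space N" "sets N = sets M"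
    "\<And>A. A \<in> sets M \<Longrightarrow> emeasure N A = 0 \<longleftrightarrow> emeasure M A = 0"
proof -
  obtain f :: "_ \<Rightarrow> real" where f[measurable]: "f \<in> borel_measurable M" and "\<And>x. 0 < f x" and int: "integrable M f"
    using sigma_finite_measure.obtain_positive_integrable_function[OF assms(1)] by metis
  define c where "c = (\<integral>\<^sup>+x. ennreal (f x) \<partial>M)"
  have c: "c \<noteq> \<infinity>"
    using int \<open>\<And>x. 0 < f x\<close> unfolding c_def integrable_iff_bounded by (auto simp: less_imp_le)
  have "c \<noteq> 0"
  proof
    assume "c = 0"
    then have "AE x in M. False"
      unfolding c_def by (subst (asm) nn_integral_0_iff_AE) (use \<open>\<And>x. 0 < f x\<close> in \<open>auto simp: ennreal_eq_0_iff not_le\<close>)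
    then have "emeasure M (space M) = 0"
      using emeasure_eq_0_AE[of "\<lambda>_. True" M] by simp
    with assms(2) show False by simp
  qed
  define N where "N = density M (\<lambda>x. ennreal (f x) / c)"
  show thesis
  proof (rule that[of N])
    show "sets N = sets M" by (simp add: N_def)
    show "prob_space N"
    proof
      have "emeasure N (space N) = (\<integral>\<^sup>+x. ennreal (f x) / c \<partial>M)"
        by (simp add: N_def emeasure_density cong: nn_integral_cong)
      also have "\<dots> = c / c" unfolding c_def by (rule nn_integral_divide) measurable
      also have "\<dots> = 1" using c \<open>c \<noteq> 0\<close> by (intro ennreal_divide_self) (auto simp: less_top)
      finally show "emeasure N (space N) = 1" .
    qed
    fix A assume A: "A \<in> sets M"
    have "emeasure N A = 0 \<longleftrightarrow> (AE x in M. x \<in> A \<longrightarrow> ennreal (f x) / c = 0)"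
      using null_sets_density_iff[of "\<lambda>x. ennreal (f x) / c" M A] A by (auto simp: N_def null_sets_def)
    also have "\<dots> \<longleftrightarrow> (AE x in M. x \<notin> A)"
    proof -
      have "ennreal (f x) \<noteq> 0" for x
        using \<open>\<And>x. 0 < f x\<close>[of x] by (simp add: ennreal_eq_0_iff not_le)
      then show ?thesis using c by (simp add: ennreal_divide_eq_0_iff)
    qed
    also have "\<dots> \<longleftrightarrow> emeasure M A = 0"
      using A AE_iff_null_sets[OF A] by (auto simp: null_sets_def)
    finally show "emeasure N A = 0 \<longleftrightarrow> emeasure M A = 0" .
  qed
qed

context
  fixes R :: "(real \<Rightarrow> 'a::polish_space) measure"
  assumes markov: "Markov R" and irred: "irreducible_path_measure R"
begin

lemma conditionable_R: "conditionable R"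
  using markov by (simp add: Markov_def)

lemmas space_paths = space_conditionable[OF conditionable_R]

text \<open>With respect to \<open>marginal R t\<close>, this is the transition density from time \<open>s\<close> to time \<open>t\<close>.
  The null sets of the joint laws only depend on where it vanishes, and by irreducibility it does
  so almost nowhere.\<close>

definition trans_density :: "real \<Rightarrow> real \<Rightarrow> 'a \<times> 'a \<Rightarrow> ennreal" where
  "trans_density s t = RN_deriv (marginal R s \<Otimes>\<^sub>M marginal R t) (marginal2 R s t)"

lemma sets_marginal: "sets (marginal R t) = sets borel"
  by (simp add: marginal_def)

lemma measurable_trans_density [measurable]:
  "trans_density s t \<in> borel_measurable (borel \<Otimes>\<^sub>M borel)"
proof -
  have "sets (marginal R s \<Otimes>\<^sub>M marginal R t) = sets (borel \<Otimes>\<^sub>M borel)"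
    by (intro sets_pair_measure_cong sets_marginal)
  then show ?thesis
    using borel_measurable_RN_deriv[of "marginal R s \<Otimes>\<^sub>M marginal R t" "marginal2 R s t"]
      measurable_cong_sets[of _ _ borel borel] unfolding trans_density_def by blast
qed

lemma marginal2_eq_density:
  assumes "0 \<le> s" "s < t" "t \<le> 1"
  shows "marginal2 R s t = density (marginal R s \<Otimes>\<^sub>M marginal R t) (trans_density s t)"
    and "AE z in marginal R s \<Otimes>\<^sub>M marginal R t. trans_density s t z \<noteq> 0"
proof -
  let ?RR = "marginal R s \<Otimes>\<^sub>M marginal R t"
  interpret s: sigma_finite_measure "marginal R s"
    using assms by (intro sigma_finite_marginal[OF conditionable_R]) auto
  interpret t: sigma_finite_measure "marginal R t"
    using assms by (intro sigma_finite_marginal[OF conditionable_R]) auto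
  interpret st: pair_sigma_finite "marginal R s" "marginal R t" ..
  have sets: "sets ?RR = sets (borel \<Otimes>\<^sub>M borel)"
    by (intro sets_pair_measure_cong sets_marginal)
  have ac: "absolutely_continuous ?RR (marginal2 R s t)" "absolutely_continuous (marginal2 R s t) ?RR"
    using irred assms unfolding irreducible_path_measure_def by auto
  show eq: "marginal2 R s t = density ?RR (trans_density s t)"
    unfolding trans_density_def
    by (rule st.density_RN_deriv[symmetric, OF ac(1)]) (simp add: marginal2_def sets)
  let ?Z = "{z \<in> space ?RR. trans_density s t z = 0}"
  have m: "trans_density s t \<in> borel_measurable ?RR"
    by (simp add: trans_density_def)
  have Z: "?Z \<in> sets ?RR" using m by measurable
  have "?Z \<in> null_sets (marginal2 R s t)"
    unfolding eq using m Z by (subst null_sets_density_iff) auto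
  then have "?Z \<in> null_sets ?RR" using ac(2) by (auto simp: absolutely_continuous_def)
  then show "AE z in ?RR. trans_density s t z \<noteq> 0"
    by (rule AE_I') auto
qed

lemma cond_prob_at_future:
  assumes st: "0 \<le> s" "s < t" "t \<le> 1" and C: "C \<in> sets borel"
  shows "AE \<omega> in R. (\<integral>\<^sup>+z. indicator C z * trans_density s t (\<omega> s, z) \<partial>marginal R t) =
    cond_prob_at R s {\<omega>\<in>paths. \<omega> t \<in> C} \<omega>"
  unfolding cond_prob_at_def
proof (rule sigma_finite_subalgebra.nn_cond_exp_charact)
  have s01: "s \<in> {0..1}" and t01: "t \<in> {0..1}" using st by auto
  show "sigma_finite_subalgebra R (path_sigma {s})"
    by (rule sigma_finite_subalgebra_path_sigma[OF conditionable_R s01])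
  note [measurable] = measurable_canonical_R[OF conditionable_R s01] measurable_canonical_R[OF conditionable_R t01] C
  interpret t: sigma_finite_measure "marginal R t"
    using sigma_finite_marginal[OF conditionable_R t01] .
  note [measurable_cong] = sets_marginal
  have C': "{\<omega> \<in> paths. \<omega> t \<in> C} \<in> sets R"
    unfolding space_paths[symmetric] by measurable
  then show "indicator {\<omega> \<in> paths. \<omega> t \<in> C} \<in> borel_measurable R" by simp
  have q: "(\<lambda>x. \<integral>\<^sup>+z. indicator C z * trans_density s t (x, z) \<partial>marginal R t) \<in> borel_measurable borel"
    by measurable
  show "(\<lambda>\<omega>. \<integral>\<^sup>+z. indicator C z * trans_density s t (\<omega> s, z) \<partial>marginal R t) \<in> borel_measurable (path_sigma {s})"
    by (rule measurable_compose[OF measurable_canonical_path_sigma q]) simp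
  fix D assume "D \<in> sets (path_sigma {s} :: (real \<Rightarrow> 'a) measure)"
  then obtain D0 where D0: "D0 \<in> sets (\<Pi>\<^sub>M t\<in>{s}. (borel :: 'a measure))"
      and D: "D = {\<omega> \<in> paths. restrict \<omega> {s} \<in> D0}"
    unfolding path_sigma_def by (subst (asm) sets_vimage_algebra2) (auto simp: space_PiM vimage_def Int_def conj_commute)
  define D1 where "D1 = (\<lambda>x. \<lambda>_\<in>{s}. x) -` D0 \<inter> space (borel :: 'a measure)"
  have "(\<lambda>x. \<lambda>_\<in>{s}. x) \<in> measurable borel (\<Pi>\<^sub>M t\<in>{s}. (borel :: 'a measure))"
    by measurable
  then have D1[measurable]: "D1 \<in> sets borel" using D0 unfolding D1_def by (rule measurable_sets)
  have D_eq: "D = {\<omega> \<in> paths. \<omega> s \<in> D1}"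
  proof -
    have "restrict \<omega> {s} \<in> D0 \<longleftrightarrow> \<omega> s \<in> D1" for \<omega>
    proof -
      have "restrict \<omega> {s} = (\<lambda>_\<in>{s}. \<omega> s)" by auto
      then show ?thesis unfolding D1_def by (subst \<open>restrict \<omega> {s} = _\<close>) simp
    qed
    then show ?thesis unfolding D by simp
  qed
  have "(\<integral>\<^sup>+\<omega>\<in>D. indicator {\<omega> \<in> paths. \<omega> t \<in> C} \<omega> \<partial>R) =
      (\<integral>\<^sup>+\<omega>. indicator (D1 \<times> C) (\<omega> s, \<omega> t) \<partial>R)"
    unfolding D_eq space_paths[symmetric] by (rule nn_integral_cong) (auto simp: indicator_def)
  also have "\<dots> = (\<integral>\<^sup>+z. indicator (D1 \<times> C) z \<partial>marginal2 R s t)"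
    unfolding marginal2_def by (subst nn_integral_distr) auto
  also have "\<dots> = (\<integral>\<^sup>+z. trans_density s t z * indicator (D1 \<times> C) z \<partial>(marginal R s \<Otimes>\<^sub>M marginal R t))"
    unfolding marginal2_eq_density[OF st] by (subst nn_integral_density) auto
  also have "\<dots> = (\<integral>\<^sup>+x. \<integral>\<^sup>+z. trans_density s t (x, z) * indicator (D1 \<times> C) (x, z) \<partial>marginal R t \<partial>marginal R s)"
    by (rule t.nn_integral_fst[symmetric]) measurable
  also have "\<dots> = (\<integral>\<^sup>+x. (\<integral>\<^sup>+z. indicator C z * trans_density s t (x, z) \<partial>marginal R t) * indicator D1 x \<partial>marginal R s)"
    by (intro nn_integral_cong) (auto simp: indicator_def intro!: nn_integral_cong)
  also have "\<dots> = (\<integral>\<^sup>+\<omega>. (\<integral>\<^sup>+z. indicator C z * trans_density s t (\<omega> s, z) \<partial>marginal R t) * indicator D1 (\<omega> s) \<partial>R)"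
    unfolding marginal_def[of R s] by (subst nn_integral_distr) (use q in auto)
  also have "\<dots> = (\<integral>\<^sup>+\<omega>\<in>D. (\<integral>\<^sup>+z. indicator C z * trans_density s t (\<omega> s, z) \<partial>marginal R t) \<partial>R)"
    unfolding D_eq space_paths[symmetric] by (rule nn_integral_cong) (auto simp: indicator_def)
  finally show "(\<integral>\<^sup>+\<omega>\<in>D. indicator {\<omega> \<in> paths. \<omega> t \<in> C} \<omega> \<partial>R) =
      (\<integral>\<^sup>+\<omega>\<in>D. (\<integral>\<^sup>+z. indicator C z * trans_density s t (\<omega> s, z) \<partial>marginal R t) \<partial>R)" .
qed

abbreviation law :: "real set \<Rightarrow> (real \<Rightarrow> 'a) measure" where
  "law S \<equiv> distr R (\<Pi>\<^sub>M t\<in>S. borel) (\<lambda>\<omega>. restrict \<omega> S)"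

text \<open>The Markov property at \<open>s = max S\<close>: conditionally on \<open>X\<^sub>s\<close>, the past event and the event at
  time \<open>t\<close> are independent, and the conditional probability of the latter is the integral of the
  transition density.\<close>

lemma joint_law_rectangle:
  assumes S: "S \<subseteq> {0..s}" "s \<in> S" and st: "s < t" "t \<le> 1"
    and A: "A \<in> sets (\<Pi>\<^sub>M t\<in>S. (borel :: 'a measure))" and C: "C \<in> sets borel"
  shows "emeasure R {\<omega> \<in> paths. restrict \<omega> S \<in> A \<and> \<omega> t \<in> C} =
    (\<integral>\<^sup>+x. indicator A x * (\<integral>\<^sup>+z. indicator C z * trans_density s t (x s, z) \<partial>marginal R t) \<partial>law S)"
proof -
  have s0: "0 \<le> s" using S by auto
  have s01: "s \<in> {0..1}" and t01: "t \<in> {0..1}" and S01: "S \<subseteq> {0..1}" using s0 st S by auto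
  note mS = measurable_restrict_R[OF conditionable_R S01]
  note [measurable] = measurable_canonical_R[OF conditionable_R s01] measurable_canonical_R[OF conditionable_R t01] C A mS
  note [measurable_cong] = sets_marginal
  interpret t: sigma_finite_measure "marginal R t"
    using sigma_finite_marginal[OF conditionable_R t01] .
  interpret F: sigma_finite_subalgebra R "path_sigma {s}"
    by (rule sigma_finite_subalgebra_path_sigma[OF conditionable_R s01])
  let ?A = "{\<omega> \<in> paths. restrict \<omega> S \<in> A}" and ?C = "{\<omega> \<in> paths. \<omega> t \<in> C}"
  have AC[measurable]: "?A \<in> sets R" "?C \<in> sets R"
    unfolding space_paths[symmetric] by measurable
  have A_past: "?A \<in> sets (path_sigma {0..s})"
    using restrict_event_in_path_sigma[OF S(1) A] .
  have C_fut: "?C \<in> sets (path_sigma {s..1})"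
    using measurable_sets[OF measurable_canonical_path_sigma[of t "{s..1}"] C] st
    by (simp add: vimage_def Int_def conj_commute)
  have mk: "AE \<omega> in R. cond_prob_at R s (?A \<inter> ?C) \<omega> = cond_prob_at R s ?A \<omega> * cond_prob_at R s ?C \<omega>"
    using markov s01 A_past C_fut unfolding Markov_def by blast
  have q: "(\<lambda>x. \<integral>\<^sup>+z. indicator C z * trans_density s t (x, z) \<partial>marginal R t) \<in> borel_measurable borel"
    by measurable
  have "emeasure R {\<omega> \<in> paths. restrict \<omega> S \<in> A \<and> \<omega> t \<in> C} = (\<integral>\<^sup>+\<omega>. 1 * indicator (?A \<inter> ?C) \<omega> \<partial>R)"
    using sets.Int[OF AC] by (simp add: Int_def conj_ac cong: conj_cong)
  also have "\<dots> = (\<integral>\<^sup>+\<omega>. 1 * cond_prob_at R s (?A \<inter> ?C) \<omega> \<partial>R)"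
    unfolding cond_prob_at_def by (rule F.nn_cond_exp_intg[symmetric]) auto
  also have "\<dots> = (\<integral>\<^sup>+\<omega>. cond_prob_at R s ?C \<omega> * cond_prob_at R s ?A \<omega> \<partial>R)"
    using mk by (intro nn_integral_cong_AE) (auto simp: mult.commute elim!: AE_mp intro!: AE_I2)
  also have "\<dots> = (\<integral>\<^sup>+\<omega>. cond_prob_at R s ?C \<omega> * indicator ?A \<omega> \<partial>R)"
    unfolding cond_prob_at_def by (rule F.nn_cond_exp_intg) auto
  also have "\<dots> = (\<integral>\<^sup>+\<omega>. indicator A (restrict \<omega> S) *
      (\<integral>\<^sup>+z. indicator C z * trans_density s t (restrict \<omega> S s, z) \<partial>marginal R t) \<partial>R)"
  proof (rule nn_integral_cong_AE)
    show "AE \<omega> in R. cond_prob_at R s ?C \<omega> * indicator ?A \<omega> = indicator A (restrict \<omega> S) *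
      (\<integral>\<^sup>+z. indicator C z * trans_density s t (restrict \<omega> S s, z) \<partial>marginal R t)"
      using cond_prob_at_future[OF s0 st C] AE_space
    proof eventually_elim
      case (elim \<omega>)
      have "indicator ?A \<omega> = (indicator A (restrict \<omega> S) :: ennreal)"
        using elim(2) by (auto simp: space_paths indicator_def)
      then show ?case using S(2) by (simp only: elim(1)[symmetric] restrict_apply if_True mult.commute)
    qed
  qed
  also have "\<dots> = (\<integral>\<^sup>+x. indicator A x *
      (\<integral>\<^sup>+z. indicator C z * trans_density s t (x s, z) \<partial>marginal R t) \<partial>law S)"
  proof -
    have ev: "(\<lambda>x. x s) \<in> measurable (\<Pi>\<^sub>M t\<in>S. (borel :: 'a measure)) borel"
      using S(2) by (rule measurable_component_singleton)
    have "(\<lambda>x. indicator A x * (\<integral>\<^sup>+z. indicator C z * trans_density s t (x s, z) \<partial>marginal R t))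
        \<in> borel_measurable (\<Pi>\<^sub>M t\<in>S. borel)"
      by (rule borel_measurable_times_ennreal[OF borel_measurable_indicator[OF A] measurable_compose[OF ev q]])
    then show ?thesis by (subst nn_integral_distr[OF mS]) simp_all
  qed
  finally show ?thesis .
qed

text \<open>Rectangles determine the joint law, because those with first factor \<open>{x. x s \<in> X i}\<close> exhaust
  the space with finite measure.\<close>

lemma joint_law_eq_density:
  assumes S: "S \<subseteq> {0..s}" "s \<in> S" and st: "s < t" "t \<le> 1"
  shows "distr R ((\<Pi>\<^sub>M t\<in>S. borel) \<Otimes>\<^sub>M borel) (\<lambda>\<omega>. (restrict \<omega> S, \<omega> t)) =
    density (law S \<Otimes>\<^sub>M marginal R t) (\<lambda>z. trans_density s t (fst z s, snd z))" (is "?L = ?D")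
proof -
  have s01: "s \<in> {0..1}" and t01: "t \<in> {0..1}" and S01: "S \<subseteq> {0..1}" using st S by auto
  note mS = measurable_restrict_R[OF conditionable_R S01]
  note [measurable] = measurable_canonical_R[OF conditionable_R s01] measurable_canonical_R[OF conditionable_R t01] mS
  note [measurable_cong] = sets_marginal
  have [measurable]: "(\<lambda>x. x s) \<in> measurable (\<Pi>\<^sub>M t\<in>S. (borel :: 'a measure)) borel"
    using S(2) by (rule measurable_component_singleton)
  interpret t: sigma_finite_measure "marginal R t"
    using sigma_finite_marginal[OF conditionable_R t01] .
  interpret s: sigma_finite_measure "marginal R s"
    using sigma_finite_marginal[OF conditionable_R s01] .
  let ?PS = "\<Pi>\<^sub>M t\<in>S. (borel :: 'a measure)"
  let ?E = "{A \<times> C | A C. A \<in> sets ?PS \<and> C \<in> sets (borel :: 'a measure)}"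
  obtain X :: "nat \<Rightarrow> 'a set" where X: "range X \<subseteq> sets (marginal R s)" "(\<Union>i. X i) = space (marginal R s)"
      "\<And>i. emeasure (marginal R s) (X i) \<noteq> \<infinity>"
    using s.sigma_finite by metis
  have Xb[measurable]: "X i \<in> sets borel" for i using X(1) sets_marginal by auto
  let ?X = "\<lambda>i. {x \<in> space ?PS. x s \<in> X i} \<times> (UNIV :: 'a set)"
  have rect: "emeasure ?L (A \<times> C) = emeasure R {\<omega> \<in> paths. restrict \<omega> S \<in> A \<and> \<omega> t \<in> C}"
    if [measurable]: "A \<in> sets ?PS" "C \<in> sets borel" for A C
  proof -
    have "A \<times> C \<in> sets (?PS \<Otimes>\<^sub>M borel)" by measurable
    then have "emeasure ?L (A \<times> C) = emeasure R ((\<lambda>\<omega>. (restrict \<omega> S, \<omega> t)) -` (A \<times> C) \<inter> space R)"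
      by (intro emeasure_distr) measurable
    also have "(\<lambda>\<omega>. (restrict \<omega> S, \<omega> t)) -` (A \<times> C) \<inter> space R = {\<omega> \<in> paths. restrict \<omega> S \<in> A \<and> \<omega> t \<in> C}"
      by (auto simp: space_paths)
    finally show ?thesis .
  qed
  show ?thesis
  proof (rule measure_eqI_generator_eq[where E = ?E and \<Omega> = "space ?PS \<times> UNIV" and A = ?X])
    show "Int_stable ?E"
      using Int_stable_pair_measure_generator[of ?PS "borel :: 'a measure"] by simp
    show "?E \<subseteq> Pow (space ?PS \<times> UNIV)"
      by (auto dest: sets.sets_into_space)
    show "sets ?L = sigma_sets (space ?PS \<times> UNIV) ?E"
      by (simp add: sets_pair_measure)
    have "sets ?D = sets (?PS \<Otimes>\<^sub>M borel)"
      by (auto intro!: sets_pair_measure_cong sets_marginal)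
    then show "sets ?D = sigma_sets (space ?PS \<times> UNIV) ?E"
      by (simp add: sets_pair_measure)
    have Xm: "{x \<in> space ?PS. x s \<in> X i} \<in> sets ?PS" for i by measurable
    show "range ?X \<subseteq> ?E"
    proof (rule image_subsetI)
      fix i
      show "?X i \<in> ?E"
        using Xm[of i] by (intro CollectI exI[of _ "{x \<in> space ?PS. x s \<in> X i}"] exI[of _ UNIV]) simp
    qed
    show "(\<Union>i. ?X i) = space ?PS \<times> UNIV"
      using X(2) by (auto simp: marginal_def)
    show "emeasure ?L (?X i) \<noteq> \<infinity>" for i
    proof -
      have "emeasure ?L (?X i) = emeasure R {\<omega> \<in> paths. \<omega> s \<in> X i}"
        unfolding rect[OF Xm, of UNIV, simplified]
        using S(2) by (intro arg_cong[where f = "emeasure R"]) (auto simp: space_PiM)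
      also have "\<dots> = emeasure (marginal R s) (X i)"
        unfolding marginal_def by (subst emeasure_distr) (auto simp: space_paths intro!: arg_cong[where f = "emeasure R"])
      finally show ?thesis using X(3) by simp
    qed
    fix Y assume "Y \<in> ?E"
    then obtain A C where Y: "Y = A \<times> C" and [measurable]: "A \<in> sets ?PS" "C \<in> sets borel" by auto
    have "emeasure ?D Y = (\<integral>\<^sup>+z. trans_density s t (fst z s, snd z) * indicator (A \<times> C) z \<partial>(law S \<Otimes>\<^sub>M marginal R t))"
      unfolding Y by (rule emeasure_density) measurable
    also have "\<dots> = (\<integral>\<^sup>+x. \<integral>\<^sup>+z. trans_density s t (x s, z) * indicator (A \<times> C) (x, z) \<partial>marginal R t \<partial>law S)"
      by (subst t.nn_integral_fst[symmetric]) auto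
    also have "\<dots> = (\<integral>\<^sup>+x. indicator A x * (\<integral>\<^sup>+z. indicator C z * trans_density s t (x s, z) \<partial>marginal R t) \<partial>law S)"
      by (intro nn_integral_cong) (auto simp: indicator_def intro!: nn_integral_cong)
    also have "\<dots> = emeasure ?L Y"
      unfolding Y by (subst rect) (auto simp: joint_law_rectangle[OF S st])
    finally show "emeasure ?L Y = emeasure ?D Y" by simp
  qed
qed

text \<open>Induction over the times in increasing order: by \<open>joint_law_eq_density\<close>, adding a time \<open>t\<close> beyond
  \<open>S\<close> replaces the law by one with an almost everywhere nonzero density relative to the product
  with the marginal at \<open>t\<close>. The Markov property needs a time to condition on, so that a single time is treated
  separately.\<close>

lemma law_null_iff_product_null:
  fixes \<rho> :: "real \<Rightarrow> 'a measure"
  assumes \<rho>: "\<And>t. prob_space (\<rho> t)" "\<And>t. sets (\<rho> t) = sets borel"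
    and \<rho>_null: "\<And>t A. t \<in> {0..1} \<Longrightarrow> A \<in> sets borel \<Longrightarrow> emeasure (\<rho> t) A = 0 \<longleftrightarrow> emeasure (marginal R t) A = 0"
    and "finite S" "S \<noteq> {}" "S \<subseteq> {0..1}"
    and "B \<in> sets (\<Pi>\<^sub>M t\<in>S. (borel :: 'a measure))"
  shows "emeasure (law S) B = 0 \<longleftrightarrow> emeasure (PiM S \<rho>) B = 0"
  using assms(4-)
proof (induction S arbitrary: B rule: finite_linorder_max_induct)
  case empty
  then show ?case by simp
next
  case (insert t S)
  note [measurable_cong] = \<rho>(2) sets_marginal
  have t01: "t \<in> {0..1}" and S01: "S \<subseteq> {0..1}" and iS01: "insert t S \<subseteq> {0..1}" and tS: "t \<notin> S"
    using insert.prems insert.hyps by auto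
  note mS = measurable_restrict_R[OF conditionable_R S01]
  note miS = measurable_restrict_R[OF conditionable_R iS01]
  note [measurable] = mS miS measurable_canonical_R[OF conditionable_R t01]
  interpret \<rho>: product_sigma_finite \<rho>
    by (simp add: product_sigma_finite_def \<rho>(1) prob_space_imp_sigma_finite)
  interpret \<rho>t: prob_space "\<rho> t" by (rule \<rho>(1))
  interpret t: sigma_finite_measure "marginal R t"
    using sigma_finite_marginal[OF conditionable_R t01] .
  note B = insert.prems(3)
  have sets_PS: "sets (PiM S \<rho>) = sets (\<Pi>\<^sub>M t\<in>S. (borel :: 'a measure))"
    "sets (PiM (insert t S) \<rho>) = sets (\<Pi>\<^sub>M t\<in>insert t S. (borel :: 'a measure))"
    by (auto intro!: sets_PiM_cong \<rho>(2))
  define J where "J = {z \<in> space ((\<Pi>\<^sub>M t\<in>S. borel) \<Otimes>\<^sub>M borel). (fst z)(t := snd z) \<in> B}"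
  have upd: "(\<lambda>z. (fst z)(t := snd z)) \<in> measurable ((\<Pi>\<^sub>M t\<in>S. borel) \<Otimes>\<^sub>M borel) (\<Pi>\<^sub>M t\<in>insert t S. (borel :: 'a measure))"
    using measurable_add_dim[of t S "\<lambda>_. borel :: 'a measure"] by (simp add: case_prod_beta')
  have J[measurable]: "J \<in> sets ((\<Pi>\<^sub>M t\<in>S. borel) \<Otimes>\<^sub>M (borel :: 'a measure))"
    using measurable_sets[OF upd B] unfolding J_def by (simp add: vimage_def Int_def conj_commute)
  have "emeasure (PiM (insert t S) \<rho>) B = (\<integral>\<^sup>+x. indicator B x \<partial>PiM (insert t S) \<rho>)"
    using B sets_PS by simp
  also have "\<dots> = (\<integral>\<^sup>+x. \<integral>\<^sup>+z. indicator B (x(t := z)) \<partial>\<rho> t \<partial>PiM S \<rho>)"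
    using B sets_PS insert.hyps(1) tS by (intro \<rho>.product_nn_integral_insert) auto
  also have "\<dots> = (\<integral>\<^sup>+x. \<integral>\<^sup>+z. indicator J (x, z) \<partial>\<rho> t \<partial>PiM S \<rho>)"
    by (intro nn_integral_cong)
      (auto simp: J_def indicator_def space_PiM space_pair_measure sets_eq_imp_space_eq[OF \<rho>(2)])
  finally have prod: "emeasure (PiM (insert t S) \<rho>) B = (\<integral>\<^sup>+x. \<integral>\<^sup>+z. indicator J (x, z) \<partial>\<rho> t \<partial>PiM S \<rho>)" .
  have law: "emeasure (law (insert t S)) B =
      emeasure (distr R ((\<Pi>\<^sub>M t\<in>S. borel) \<Otimes>\<^sub>M borel) (\<lambda>\<omega>. (restrict \<omega> S, \<omega> t))) J"
  proof -
    have "emeasure (law (insert t S)) B = emeasure R ((\<lambda>\<omega>. restrict \<omega> (insert t S)) -` B \<inter> space R)"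
      by (rule emeasure_distr[OF miS B])
    also have "(\<lambda>\<omega>. restrict \<omega> (insert t S)) -` B \<inter> space R = (\<lambda>\<omega>. (restrict \<omega> S, \<omega> t)) -` J \<inter> space R"
    proof -
      have "restrict \<omega> (insert t S) = (restrict \<omega> S)(t := \<omega> t)" for \<omega> :: "real \<Rightarrow> 'a"
        by auto
      then show ?thesis by (auto simp: J_def space_pair_measure space_PiM)
    qed
    also have "emeasure R \<dots> = emeasure (distr R ((\<Pi>\<^sub>M t\<in>S. borel) \<Otimes>\<^sub>M borel) (\<lambda>\<omega>. (restrict \<omega> S, \<omega> t))) J"
      by (rule emeasure_distr[symmetric]) (use J in measurable)
    finally show ?thesis .
  qed
  have slice[measurable]: "{z. (x, z) \<in> J} \<in> sets borel" for x
    using sets_Pair1[OF J] by (simp add: vimage_def)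
  have slice_eq: "(\<integral>\<^sup>+z. indicator J (x, z) \<partial>N) = emeasure N {z. (x, z) \<in> J}" if "sets N = sets borel" for x N
  proof -
    have "(\<integral>\<^sup>+z. indicator J (x, z) \<partial>N) = (\<integral>\<^sup>+z. indicator {z. (x, z) \<in> J} z \<partial>N)"
      by (rule nn_integral_cong) (simp add: indicator_def)
    then show ?thesis using slice that by simp
  qed
  have slices: "(\<integral>\<^sup>+z. indicator J (x, z) \<partial>\<rho> t) = 0 \<longleftrightarrow> (\<integral>\<^sup>+z. indicator J (x, z) \<partial>marginal R t) = 0" for x
    using \<rho>_null[OF t01 slice] by (simp add: slice_eq[OF \<rho>(2)] slice_eq[OF sets_marginal])
  show ?case
  proof (cases "S = {}")
    case True
    let ?u = "\<lambda>_. undefined :: 'a"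
    have ru: "restrict \<omega> {} = ?u" for \<omega> :: "real \<Rightarrow> 'a" by auto
    have pair_m: "(\<lambda>\<omega>. (restrict \<omega> S, \<omega> t)) \<in> measurable R ((\<Pi>\<^sub>M t\<in>S. borel) \<Otimes>\<^sub>M borel)"
      by measurable
    have "emeasure (PiM (insert t S) \<rho>) B = (\<integral>\<^sup>+x. \<integral>\<^sup>+z. indicator J (x, z) \<partial>\<rho> t \<partial>PiM {} \<rho>)"
      using prod True by simp
    also have "\<dots> = (\<integral>\<^sup>+z. indicator J (?u, z) \<partial>\<rho> t)"
      by (rule \<rho>.nn_integral_empty) simp
    finally have "emeasure (PiM (insert t S) \<rho>) B = (\<integral>\<^sup>+z. indicator J (?u, z) \<partial>\<rho> t)" .
    moreover have "emeasure (law (insert t S)) B = (\<integral>\<^sup>+z. indicator J (?u, z) \<partial>marginal R t)"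
    proof -
      have "emeasure (law (insert t S)) B = emeasure R ((\<lambda>\<omega>. \<omega> t) -` {z. (?u, z) \<in> J} \<inter> space R)"
        unfolding law emeasure_distr[OF pair_m J]
        by (rule arg_cong[where f = "emeasure R"]) (auto simp: ru True)
      also have "\<dots> = emeasure (marginal R t) {z. (?u, z) \<in> J}"
        unfolding marginal_def by (rule emeasure_distr[symmetric]) auto
      finally show ?thesis by (simp add: slice_eq[OF sets_marginal])
    qed
    ultimately show ?thesis by (simp only: slices)
  next
    case False
    define s where "s = Max S"
    have s: "s \<in> S" "S \<subseteq> {0..s}" "s < t" "t \<le> 1"
      using False insert.hyps insert.prems by (auto simp: s_def intro: Max_ge)
    have s01: "s \<in> {0..1}" using s by auto
    interpret s: sigma_finite_measure "marginal R s"
      using sigma_finite_marginal[OF conditionable_R s01] .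
    interpret S: sigma_finite_measure "law S"
      by (rule sigma_finite_restrict_R[OF conditionable_R S01 s(1)])
    interpret St: pair_sigma_finite "law S" "marginal R t" ..
    interpret st: pair_sigma_finite "marginal R s" "marginal R t" ..
    have ev[measurable]: "(\<lambda>x. x s) \<in> measurable (\<Pi>\<^sub>M t\<in>S. (borel :: 'a measure)) borel"
      using s(1) by (rule measurable_component_singleton)
    have pos: "AE z in law S \<Otimes>\<^sub>M marginal R t. trans_density s t (fst z s, snd z) \<noteq> 0"
    proof -
      have "AE x in marginal R s. AE z in marginal R t. trans_density s t (x, z) \<noteq> 0"
        using st.AE_pair[OF marginal2_eq_density(2)[OF _ s(3,4)]] s01 by auto
      moreover have ms: "marginal R s = distr (law S) borel (\<lambda>x. x s)"
        unfolding marginal_def using s(1) by (subst distr_distr) (auto simp: comp_def mS)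
      ultimately have "AE x in distr (law S) borel (\<lambda>x. x s). AE z in marginal R t. trans_density s t (x, z) \<noteq> 0"
        by (simp only:)
      then have "AE x in law S. AE z in marginal R t. trans_density s t (x s, z) \<noteq> 0"
        by (rule AE_distrD[rotated]) simp
      then show ?thesis
      proof (intro St.AE_pair_measure)
        have "(\<lambda>z. trans_density s t (fst z s, snd z)) \<in> borel_measurable (law S \<Otimes>\<^sub>M marginal R t)"
          by measurable
        then show "{z \<in> space (law S \<Otimes>\<^sub>M marginal R t). trans_density s t (fst z s, snd z) \<noteq> 0}
            \<in> sets (law S \<Otimes>\<^sub>M marginal R t)"
          by (rule borel_measurable_neq) simp
      qed simp
    qed
    have Jm: "J \<in> sets (law S \<Otimes>\<^sub>M marginal R t)"
    proof -
      have "sets (law S \<Otimes>\<^sub>M marginal R t) = sets ((\<Pi>\<^sub>M t\<in>S. borel) \<Otimes>\<^sub>M (borel :: 'a measure))"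
        by (intro sets_pair_measure_cong) (simp_all add: sets_marginal)
      then show ?thesis using J by simp
    qed
    have "emeasure (law (insert t S)) B = 0 \<longleftrightarrow>
        (AE z in law S \<Otimes>\<^sub>M marginal R t. z \<in> J \<longrightarrow> trans_density s t (fst z s, snd z) = 0)"
      unfolding law joint_law_eq_density[OF s(2,1,3,4)]
      using null_sets_density_iff[of "\<lambda>z. trans_density s t (fst z s, snd z)" "law S \<Otimes>\<^sub>M marginal R t" J] Jm
      by (auto simp: null_sets_def)
    also have "\<dots> \<longleftrightarrow> (AE z in law S \<Otimes>\<^sub>M marginal R t. z \<notin> J)"
      using pos by (intro iffI; auto elim: AE_mp)
    also have "\<dots> \<longleftrightarrow> J \<in> null_sets (law S \<Otimes>\<^sub>M marginal R t)"
      using AE_iff_null_sets[OF Jm] by simp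
    also have "\<dots> \<longleftrightarrow> (\<integral>\<^sup>+x. \<integral>\<^sup>+z. indicator J (x, z) \<partial>marginal R t \<partial>law S) = 0"
      using Jm by (auto simp: null_sets_def t.emeasure_pair_measure)
    also have "\<dots> \<longleftrightarrow> (AE x in law S. (\<integral>\<^sup>+z. indicator J (x, z) \<partial>marginal R t) = 0)"
      by (rule nn_integral_0_iff_AE) measurable
    also have "\<dots> \<longleftrightarrow> (AE x in law S. (\<integral>\<^sup>+z. indicator J (x, z) \<partial>\<rho> t) = 0)"
      by (simp add: slices)
    also have "\<dots> \<longleftrightarrow> (AE x in PiM S \<rho>. (\<integral>\<^sup>+z. indicator J (x, z) \<partial>\<rho> t) = 0)"
    proof -
      let ?Z = "{x \<in> space (\<Pi>\<^sub>M t\<in>S. borel). (\<integral>\<^sup>+z. indicator J (x, z) \<partial>\<rho> t) \<noteq> 0}"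
      have Z: "?Z \<in> sets (\<Pi>\<^sub>M t\<in>S. (borel :: 'a measure))" by measurable
      have key: "(AE x in N. (\<integral>\<^sup>+z. indicator J (x, z) \<partial>\<rho> t) = 0) \<longleftrightarrow> emeasure N ?Z = 0"
        if N: "sets N = sets (\<Pi>\<^sub>M t\<in>S. (borel :: 'a measure))" for N
        using Z sets_eq_imp_space_eq[OF N] N by (subst AE_iff_measurable[of ?Z]) auto
      show ?thesis
        unfolding key[OF sets_distr] key[OF sets_PS(1)] by (rule insert.IH[OF False S01 Z])
    qed
    also have "\<dots> \<longleftrightarrow> (\<integral>\<^sup>+x. \<integral>\<^sup>+z. indicator J (x, z) \<partial>\<rho> t \<partial>PiM S \<rho>) = 0"
      by (rule nn_integral_0_iff_AE[symmetric]) measurable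
    finally show ?thesis unfolding prod .
  qed
qed

end

section \<open>Relative entropy as an integral of \<open>h ln h\<close>, and its first variation\<close>

text \<open>The densities relative to \<open>R\<close> and to the weighted probability measure differ by the factor
  \<open>z e\<^sup>W\<close>, and \<open>W\<close> is \<open>P\<close>-integrable; so the weight cancels. The value no longer depends on
  \<open>W\<close>, which is what makes the entropies of different measures comparable.\<close>

lemma rel_entropy_weighted_density:
  fixes h W :: "'b \<Rightarrow> real"
  assumes sf: "sigma_finite_measure R"
    and hm[measurable]: "h \<in> borel_measurable R" and h: "\<And>x. 0 \<le> h x"
    and P: "P = density R (\<lambda>x. ennreal (h x))" and prob: "prob_space P"
    and W: "entropy_weight P R W"
  shows "rel_entropy_weighted P R W =
    (if integrable R (\<lambda>x. h x * ln (h x)) then ereal (\<integral>x. h x * ln (h x) \<partial>R) else \<infinity>)"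
proof -
  interpret R: sigma_finite_measure R by (rule sf)
  interpret P: prob_space P by (rule prob)
  have Wm[measurable]: "W \<in> borel_measurable R" and expW: "integrable R (\<lambda>\<omega>. exp (- W \<omega>))"
    and WP: "integrable P W"
    using W by (auto simp: entropy_weight_def)
  define z where "z = weight_norm R W"
  have "z \<noteq> 0"
  proof
    assume "z = 0"
    then have "AE x in R. exp (- W x) = 0"
      using integral_nonneg_eq_0_iff_AE[OF expW] by (simp add: z_def weight_norm_def)
    then have "AE x in R. False" by simp
    then have "AE x in P. False"
      unfolding P by (subst AE_density) (auto elim: AE_mp)
    then show False by simp
  qed
  moreover have "0 \<le> z" by (simp add: z_def weight_norm_def)
  ultimately have z: "0 < z" by simp
  define w where "w x = exp (- W x) / z" for x
  have wm[measurable]: "w \<in> borel_measurable R" unfolding w_def[abs_def] by measurable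
  have w: "0 < w x" for x using z by (simp add: w_def)
  define Q where "Q = weighted_measure R W"
  have Q: "Q = density R (\<lambda>x. ennreal (w x))" by (simp add: Q_def weighted_measure_def w_def z_def)
  define H where "H x = h x / w x" for x
  have Hm[measurable]: "H \<in> borel_measurable R" unfolding H_def[abs_def] by measurable
  have H: "0 \<le> H x" for x using h[of x] w[of x] by (simp add: H_def)
  have PQ: "P = density Q (\<lambda>x. ennreal (H x))"
  proof -
    have "ennreal (w x) * ennreal (H x) = ennreal (h x)" for x
      using w[of x] H[of x] by (simp add: ennreal_mult[symmetric] H_def)
    moreover have "density Q (\<lambda>x. ennreal (H x)) = density R (\<lambda>x. ennreal (w x) * ennreal (H x))"
      unfolding Q by (rule density_density_eq) measurable
    ultimately show ?thesis unfolding P by simp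
  qed
  have sfQ: "sigma_finite_measure Q"
    unfolding Q by (subst R.sigma_finite_iff_density_finite) auto
  have "AE x in Q. ennreal (H x) = RN_deriv Q P x"
  proof (rule sigma_finite_measure.RN_deriv_unique[OF sfQ])
    show "(\<lambda>x. ennreal (H x)) \<in> borel_measurable Q" by (simp add: Q)
  qed (rule PQ[symmetric])
  then have RN: "AE x in R. RN_deriv Q P x = ennreal (H x)"
    unfolding Q using w by (subst (asm) AE_density) (auto elim: AE_mp)
  then have "AE x in P. RN_deriv Q P x = ennreal (H x)"
    unfolding P by (subst AE_density) (auto elim: AE_mp)
  then have ED: "AE x in P. entropy_density (exp 1) Q P x = ln (H x)"
    by eventually_elim (simp add: entropy_density_def log_def H)
  have setsQ: "sets Q = sets R" and setsP: "sets P = sets R" by (simp_all add: Q P)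
  have EDm: "entropy_density (exp 1) Q P \<in> borel_measurable P"
    using measurable_entropy_density[of "exp 1" Q P] setsQ setsP measurable_cong_sets by blast
  have lnHm: "(\<lambda>x. ln (H x)) \<in> borel_measurable P"
    unfolding measurable_cong_sets[OF setsP refl] by measurable
  have ac: "absolutely_continuous Q P"
    unfolding PQ by (rule absolutely_continuousI_density) (simp add: Q)
  have int_h: "integrable R h"
    using P.emeasure_space_1 h unfolding integrable_iff_bounded
    by (simp add: P emeasure_density cong: nn_integral_cong)
  have int_hW: "integrable R (\<lambda>x. h x * W x)"
    using WP unfolding P by (subst (asm) integrable_real_density) (auto simp: h)
  have int1: "(\<integral>x. h x \<partial>R) = 1"
    using P.emeasure_space_1 int_h h nn_integral_eq_integral[OF int_h]
    by (simp add: P emeasure_density cong: nn_integral_cong)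
  have split: "h x * ln (H x) = h x * ln (h x) + (h x * W x + ln z * h x)" for x
  proof (cases "h x = 0")
    case False
    then have "0 < h x" using h[of x] by simp
    then show ?thesis using z by (simp add: H_def w_def ln_div algebra_simps ln_mult)
  qed simp
  have iff: "integrable P (entropy_density (exp 1) Q P) \<longleftrightarrow> integrable R (\<lambda>x. h x * ln (h x))"
  proof -
    have "integrable P (entropy_density (exp 1) Q P) \<longleftrightarrow> integrable P (\<lambda>x. ln (H x))"
      by (rule integrable_cong_AE[OF EDm lnHm ED])
    also have "\<dots> \<longleftrightarrow> integrable R (\<lambda>x. h x * ln (H x))"
      unfolding P by (rule integrable_real_density) (auto simp: h)
    also have "\<dots> \<longleftrightarrow> integrable R (\<lambda>x. h x * ln (h x))"
    proof -
      have i2: "integrable R (\<lambda>x. h x * W x + ln z * h x)" using int_h int_hW by simp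
      show ?thesis
      proof
        assume "integrable R (\<lambda>x. h x * ln (H x))"
        from Bochner_Integration.integrable_diff[OF this i2]
        show "integrable R (\<lambda>x. h x * ln (h x))" by (simp only: split add_diff_cancel_right')
      next
        assume "integrable R (\<lambda>x. h x * ln (h x))"
        from Bochner_Integration.integrable_add[OF this i2]
        show "integrable R (\<lambda>x. h x * ln (H x))" by (simp only: split)
      qed
    qed
    finally show ?thesis .
  qed
  show ?thesis
  proof (cases "integrable R (\<lambda>x. h x * ln (h x))")
    case False
    then show ?thesis
      using iff by (simp add: rel_entropy_weighted_def rel_entropy_prob_def Q_def[symmetric])
  next
    case True
    have "KL_divergence (exp 1) Q P = (\<integral>x. ln (H x) \<partial>P)"
      unfolding KL_divergence_def by (rule integral_cong_AE[OF EDm lnHm ED])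
    also have "\<dots> = (\<integral>x. h x * ln (H x) \<partial>R)"
      unfolding P by (rule integral_real_density) (auto simp: h)
    also have "\<dots> = (\<integral>x. h x * ln (h x) \<partial>R) + ((\<integral>x. h x * W x \<partial>R) + ln z)"
      unfolding split using True int_h int_hW by (simp add: int1)
    finally have "KL_divergence (exp 1) Q P = (\<integral>x. h x * ln (h x) \<partial>R) + ((\<integral>x. h x * W x \<partial>R) + ln z)" .
    moreover have "(\<integral>x. W x \<partial>P) = (\<integral>x. h x * W x \<partial>R)"
      unfolding P by (rule integral_real_density) (auto simp: h)
    ultimately show ?thesis
      using True iff ac by (simp add: rel_entropy_weighted_def rel_entropy_prob_def Q_def[symmetric] z_def[symmetric])
  qed
qed

lemma rel_entropy_density:
  fixes h :: "'b \<Rightarrow> real"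
  assumes "sigma_finite_measure R" "h \<in> borel_measurable R" "\<And>x. 0 \<le> h x"
    and "P = density R (\<lambda>x. ennreal (h x))" "prob_space P"
    and "rel_entropy_defined P R"
  shows "rel_entropy P R =
    (if integrable R (\<lambda>x. h x * ln (h x)) then ereal (\<integral>x. h x * ln (h x) \<partial>R) else \<infinity>)"
  unfolding rel_entropy_def
proof (rule rel_entropy_weighted_density[OF assms(1-5)])
  show "entropy_weight P R (SOME W. entropy_weight P R W)"
    using assms(6) unfolding rel_entropy_defined_def by (rule someI_ex)
qed

lemma finite_rel_entropy_density:
  assumes sf: "sigma_finite_measure R" and "sets P = sets R" and prob: "prob_space P"
    and def: "rel_entropy_defined P R" and fin: "rel_entropy P R < \<infinity>"
  obtains h :: "'b \<Rightarrow> real" where "h \<in> borel_measurable R" "\<And>x. 0 \<le> h x"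
    "P = density R (\<lambda>x. ennreal (h x))" "integrable R (\<lambda>x. h x * ln (h x))"
proof -
  define W where "W = (SOME W. entropy_weight P R W)"
  have W: "entropy_weight P R W"
    using def unfolding W_def rel_entropy_defined_def by (rule someI_ex)
  have "rel_entropy_prob P (weighted_measure R W) \<noteq> \<infinity>"
    using fin unfolding rel_entropy_def W_def[symmetric] rel_entropy_weighted_def by auto
  then have "absolutely_continuous (weighted_measure R W) P"
    by (auto simp: rel_entropy_prob_def split: if_splits)
  moreover have "absolutely_continuous R (weighted_measure R W)"
    unfolding weighted_measure_def
    by (rule absolutely_continuousI_density) (use W in \<open>auto simp: entropy_weight_def\<close>)
  ultimately have ac: "absolutely_continuous R P"
    by (auto simp: absolutely_continuous_def)
  interpret P: prob_space P by (rule prob)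
  obtain D where D: "D \<in> borel_measurable R" "AE x in R. RN_deriv R P x = ennreal (D x)"
      "AE x in P. 0 < D x" "\<And>x. 0 \<le> D x"
    using sigma_finite_measure.real_RN_deriv[OF sf P.finite_measure_axioms ac assms(2)] by metis
  have P: "P = density R (\<lambda>x. ennreal (D x))"
    using sigma_finite_measure.density_RN_deriv[OF sf ac assms(2)]
      density_cong[OF _ _ D(2)] D(1) by simp
  show thesis
  proof (rule that[OF D(1,4) P])
    show "integrable R (\<lambda>x. D x * ln (D x))"
      using rel_entropy_density[OF sf D(1,4) P prob def] fin by (auto split: if_splits)
  qed
qed

text \<open>Minimality in the form in which it is used throughout. The perturbed measure needs a weight of its
  own: where \<open>k\<close> is nonzero the weight is set to \<open>0\<close>, which costs only the finite measure of that
  set, and elsewhere the densities agree and the old weight serves.\<close>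

lemma schroedinger_solution_first_variation:
  fixes R P :: "(real \<Rightarrow> 'a::polish_space) measure" and h k :: "(real \<Rightarrow> 'a) \<Rightarrow> real"
  assumes sol: "schroedinger_solution R T \<mu> P"
    and sf: "sigma_finite_measure R" and sets_R: "sets R = sets path_borel"
    and T: "T \<subseteq> {0..1}" "T \<noteq> {}"
    and hm[measurable]: "h \<in> borel_measurable R" and h: "\<And>\<omega>. 0 \<le> h \<omega>"
    and P: "P = density R (\<lambda>\<omega>. ennreal (h \<omega>))" and hlnh: "integrable R (\<lambda>\<omega>. h \<omega> * ln (h \<omega>))"
    and k: "integrable R k" and hk: "\<And>\<omega>. 0 \<le> h \<omega> + k \<omega>"
    and supp: "emeasure R {\<omega> \<in> space R. k \<omega> \<noteq> 0} < \<infinity>"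
    and marg: "\<And>s A. s \<in> T \<Longrightarrow> A \<in> sets borel \<Longrightarrow> (\<integral>\<omega>. indicator A (\<omega> s) * k \<omega> \<partial>R) = 0"
    and int: "integrable R (\<lambda>\<omega>. (h \<omega> + k \<omega>) * ln (h \<omega> + k \<omega>) - h \<omega> * ln (h \<omega>))"
  shows "0 \<le> (\<integral>\<omega>. (h \<omega> + k \<omega>) * ln (h \<omega> + k \<omega>) - h \<omega> * ln (h \<omega>) \<partial>R)"
proof -
  have km[measurable]: "k \<in> borel_measurable R" using k by simp
  have feas: "schroedinger_feasible T \<mu> P" and def: "rel_entropy_defined P R"
    and min: "\<And>P'. schroedinger_feasible T \<mu> P' \<Longrightarrow> rel_entropy_defined P' R \<Longrightarrow> rel_entropy P R \<le> rel_entropy P' R"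
    using sol by (auto simp: schroedinger_solution_def)
  interpret P: prob_space P using feas by (simp add: schroedinger_feasible_def)
  have int_h: "integrable R h"
    using P.emeasure_space_1 h unfolding integrable_iff_bounded
    by (simp add: P emeasure_density cong: nn_integral_cong)
  have can: "(\<lambda>\<omega>. \<omega> s) \<in> measurable R borel" if "s \<in> T" for s
    using measurable_canonical[of s] T that measurable_cong_sets[OF sets_R refl] by blast
  define P' where "P' = density R (\<lambda>\<omega>. ennreal (h \<omega> + k \<omega>))"
  have marg_eq: "emeasure P' ((\<lambda>\<omega>. \<omega> s) -` A \<inter> space R) = emeasure P ((\<lambda>\<omega>. \<omega> s) -` A \<inter> space R)"
    if s: "s \<in> T" and A[measurable]: "A \<in> sets borel" for s A
  proof -
    note [measurable] = can[OF s]
    have E: "(\<lambda>\<omega>. \<omega> s) -` A \<inter> space R \<in> sets R" by measurable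
    have em: "emeasure (density R (\<lambda>\<omega>. ennreal (f \<omega>))) ((\<lambda>\<omega>. \<omega> s) -` A \<inter> space R) =
        ennreal (\<integral>\<omega>. indicator A (\<omega> s) * f \<omega> \<partial>R)"
      if f: "integrable R f" "\<And>\<omega>. 0 \<le> f \<omega>" for f
    proof -
      have [measurable]: "f \<in> borel_measurable R" using f by simp
      have ig: "integrable R (\<lambda>\<omega>. indicator A (\<omega> s) * f \<omega>)"
        by (rule Bochner_Integration.integrable_bound[OF f(1)]) (auto simp: indicator_def)
      have "emeasure (density R (\<lambda>\<omega>. ennreal (f \<omega>))) ((\<lambda>\<omega>. \<omega> s) -` A \<inter> space R) =
          (\<integral>\<^sup>+\<omega>. ennreal (indicator A (\<omega> s) * f \<omega>) \<partial>R)"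
        using E by (subst emeasure_density) (auto intro!: nn_integral_cong simp: indicator_def)
      also have "\<dots> = ennreal (\<integral>\<omega>. indicator A (\<omega> s) * f \<omega> \<partial>R)"
        by (rule nn_integral_eq_integral[OF ig]) (simp add: f)
      finally show ?thesis .
    qed
    have ig: "integrable R (\<lambda>\<omega>. indicator A (\<omega> s) * h \<omega>)" "integrable R (\<lambda>\<omega>. indicator A (\<omega> s) * k \<omega>)"
      by (rule Bochner_Integration.integrable_bound[OF int_h] Bochner_Integration.integrable_bound[OF k];
          auto simp: indicator_def)+
    have "(\<integral>\<omega>. indicator A (\<omega> s) * (h \<omega> + k \<omega>) \<partial>R) = (\<integral>\<omega>. indicator A (\<omega> s) * h \<omega> \<partial>R)"
      using ig marg[OF s A] by (simp add: distrib_left)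
    then show ?thesis
      unfolding P'_def P using em[OF int_h h] em[OF Bochner_Integration.integrable_add[OF int_h k] hk] by simp
  qed
  have setsP': "sets P' = sets R" by (simp add: P'_def)
  have spaceP': "space P' = space R" "space P = space R" by (simp_all add: P'_def P)
  have prob': "prob_space P'"
  proof
    obtain s where "s \<in> T" using T by auto
    from marg_eq[OF this, of UNIV] show "emeasure P' (space P') = 1"
      using P.emeasure_space_1 by (simp add: spaceP')
  qed
  have feas': "schroedinger_feasible T \<mu> P'"
    unfolding schroedinger_feasible_def
  proof (intro conjI ballI prob')
    show "sets P' = sets path_borel" using setsP' sets_R by simp
    fix s assume s: "s \<in> T"
    have "marginal P' s = marginal P s"
      unfolding marginal_def
    proof (rule measure_eqI)
      fix A :: "'a set" assume "A \<in> sets (distr P' borel (\<lambda>\<omega>. \<omega> s))"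
      then have A: "A \<in> sets borel" by simp
      have "(\<lambda>\<omega>. \<omega> s) \<in> measurable P' borel" "(\<lambda>\<omega>. \<omega> s) \<in> measurable P borel"
        using can[OF s] by (simp_all add: P'_def P)
      then show "emeasure (distr P' borel (\<lambda>\<omega>. \<omega> s)) A = emeasure (distr P borel (\<lambda>\<omega>. \<omega> s)) A"
        using A marg_eq[OF s A] by (simp add: emeasure_distr spaceP')
    qed simp
    then show "marginal P' s = \<mu> s" using feas s by (simp add: schroedinger_feasible_def)
  qed
  have def': "rel_entropy_defined P' R"
  proof -
    obtain W where W: "entropy_weight P R W" using def by (auto simp: rel_entropy_defined_def)
    then have [measurable]: "W \<in> borel_measurable R" and W0: "\<And>\<omega>. \<omega> \<in> space R \<Longrightarrow> 0 \<le> W \<omega>"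
      and iW: "integrable R (\<lambda>\<omega>. exp (- W \<omega>))" and WP: "integrable P W"
      by (auto simp: entropy_weight_def)
    define V where "V \<omega> = (if k \<omega> = 0 then W \<omega> else 0)" for \<omega>
    have [measurable]: "V \<in> borel_measurable R" unfolding V_def[abs_def] by measurable
    have "entropy_weight P' R V"
      unfolding entropy_weight_def
    proof (intro conjI)
      show "V \<in> borel_measurable R" by measurable
      show "\<forall>\<omega>\<in>space R. 0 \<le> V \<omega>" using W0 by (simp add: V_def)
      have "integrable R (indicator {\<omega> \<in> space R. k \<omega> \<noteq> 0} :: _ \<Rightarrow> real)"
        using supp by (intro integrable_real_indicator) auto
      from Bochner_Integration.integrable_add[OF iW this]
      show "integrable R (\<lambda>\<omega>. exp (- V \<omega>))"
        by (rule Bochner_Integration.integrable_bound) (auto simp: V_def indicator_def intro!: AE_I2)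
      have hW: "integrable R (\<lambda>\<omega>. h \<omega> * W \<omega>)"
        using WP unfolding P by (subst (asm) integrable_real_density) (auto simp: h)
      have "integrable R (\<lambda>\<omega>. (h \<omega> + k \<omega>) * V \<omega>)"
        by (rule Bochner_Integration.integrable_bound[OF hW]) (auto simp: V_def)
      then show "integrable P' V"
        unfolding P'_def by (subst integrable_real_density) (auto simp: hk)
    qed
    then show ?thesis by (auto simp: rel_entropy_defined_def)
  qed
  have int': "integrable R (\<lambda>\<omega>. (h \<omega> + k \<omega>) * ln (h \<omega> + k \<omega>))"
    using Bochner_Integration.integrable_add[OF int hlnh] by simp
  have "rel_entropy P R \<le> rel_entropy P' R" by (rule min[OF feas' def'])
  moreover have "rel_entropy P R = ereal (\<integral>\<omega>. h \<omega> * ln (h \<omega>) \<partial>R)"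
    using rel_entropy_density[OF sf hm h P P.prob_space_axioms def] hlnh by simp
  moreover have "rel_entropy P' R = ereal (\<integral>\<omega>. (h \<omega> + k \<omega>) * ln (h \<omega> + k \<omega>) \<partial>R)"
    using rel_entropy_density[OF sf _ hk P'_def prob' def'] int' by simp
  ultimately show ?thesis using int' hlnh by simp
qed

section \<open>The optimal density depends on the constrained times only\<close>

text \<open>On \<open>D = {1/N \<le> g(X\<^sub>T) \<le> N}\<close> the density \<open>h\<close> is replaced by \<open>g(X\<^sub>T)\<close>, its conditional
  expectation given \<open>X\<^sub>T\<close>. This keeps all marginals at times in \<open>T\<close> and lowers the entropy by the
  integral of a Bregman divergence, which must therefore vanish. Where \<open>g(X\<^sub>T) = 0\<close>, also \<open>h\<close>
  vanishes, having conditional expectation zero.\<close>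

lemma schroedinger_density_sufficient:
  fixes R P :: "(real \<Rightarrow> 'a::polish_space) measure" and h :: "(real \<Rightarrow> 'a) \<Rightarrow> real"
  assumes sol: "schroedinger_solution R T \<mu> P" and cond: "conditionable R"
    and T: "T \<subseteq> {0..1}" "T \<noteq> {}"
    and hm[measurable]: "h \<in> borel_measurable R" and h: "\<And>\<omega>. 0 \<le> h \<omega>"
    and P: "P = density R (\<lambda>\<omega>. ennreal (h \<omega>))" and hlnh: "integrable R (\<lambda>\<omega>. h \<omega> * ln (h \<omega>))"
  obtains g :: "(real \<Rightarrow> 'a) \<Rightarrow> real" where "g \<in> borel_measurable (\<Pi>\<^sub>M t\<in>T. borel)" "\<And>x. 0 \<le> g x"
    "AE \<omega> in R. h \<omega> = g (restrict \<omega> T)"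
proof -
  let ?PT = "\<Pi>\<^sub>M t\<in>T. (borel :: 'a measure)" and ?X = "\<lambda>\<omega> :: real \<Rightarrow> 'a. restrict \<omega> T"
  have sf: "sigma_finite_measure R" by (rule sigma_finite_R[OF cond])
  have sets_R: "sets R = sets path_borel" by (rule sets_conditionable[OF cond])
  have X[measurable]: "?X \<in> measurable R ?PT" by (rule measurable_restrict_R[OF cond T(1)])
  have XP: "?X \<in> measurable P ?PT" using X by (simp add: P)
  interpret P: prob_space P using sol by (simp add: schroedinger_solution_def schroedinger_feasible_def)
  define L where "L = distr R ?PT ?X"
  define LP where "LP = distr P ?PT ?X"
  have sets_L: "sets L = sets ?PT" "sets LP = sets ?PT" by (simp_all add: L_def LP_def)
  obtain s0 where "s0 \<in> T" using T by auto
  then have sfL: "sigma_finite_measure L" unfolding L_def by (rule sigma_finite_restrict_R[OF cond T(1)])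
  interpret LP: prob_space LP unfolding LP_def by (rule P.prob_space_distr[OF XP])
  have ac: "absolutely_continuous L LP"
    unfolding absolutely_continuous_def
  proof
    fix A assume "A \<in> null_sets L"
    then have A: "A \<in> sets ?PT" and "?X -` A \<inter> space R \<in> null_sets R"
      by (auto simp: null_sets_def L_def emeasure_distr)
    then have "?X -` A \<inter> space R \<in> null_sets P"
      using absolutely_continuousI_density[of "\<lambda>\<omega>. ennreal (h \<omega>)" R] unfolding P absolutely_continuous_def by auto
    moreover have "space P = space R" by (simp add: P)
    ultimately have "emeasure LP A = 0"
      unfolding LP_def emeasure_distr[OF XP A] by (simp add: null_sets_def)
    then show "A \<in> null_sets LP" using A sets_L(2) by (simp add: null_sets_def)
  qed
  have sets_LP: "sets LP = sets L" using sets_L by simp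
  obtain g where g: "g \<in> borel_measurable L" "AE x in L. RN_deriv L LP x = ennreal (g x)"
      "AE x in LP. 0 < g x" "\<And>x. 0 \<le> g x"
    using sigma_finite_measure.real_RN_deriv[OF sfL LP.finite_measure_axioms ac sets_LP] by metis
  have gm[measurable]: "g \<in> borel_measurable ?PT" using g(1) by (simp add: L_def)
  have LP: "LP = density L (\<lambda>x. ennreal (g x))"
    using sigma_finite_measure.density_RN_deriv[OF sfL ac sets_LP]
      density_cong[OF _ _ g(2)] g(1) by simp
  have int_h: "integrable R h"
    using P.emeasure_space_1 h unfolding integrable_iff_bounded
    by (simp add: P emeasure_density cong: nn_integral_cong)
  have int_gL: "integrable L g"
    using LP.emeasure_space_1 g(1,4) unfolding integrable_iff_bounded
    by (simp add: LP emeasure_density cong: nn_integral_cong)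
  have int_g: "integrable R (\<lambda>\<omega>. g (?X \<omega>))"
    using int_gL unfolding L_def by (subst (asm) integrable_distr_eq) auto
  have transfer: "(\<integral>\<omega>. c (?X \<omega>) * g (?X \<omega>) \<partial>R) = (\<integral>\<omega>. c (?X \<omega>) * h \<omega> \<partial>R)"
    if [measurable]: "c \<in> borel_measurable ?PT" for c :: "(real \<Rightarrow> 'a) \<Rightarrow> real"
  proof -
    have "(\<integral>\<omega>. c (?X \<omega>) * g (?X \<omega>) \<partial>R) = (\<integral>x. c x * g x \<partial>L)"
      unfolding L_def by (rule integral_distr[symmetric]) measurable
    also have "\<dots> = (\<integral>x. c x \<partial>LP)"
      unfolding LP using g(4) by (subst integral_real_density) (auto simp: L_def mult.commute)
    also have "\<dots> = (\<integral>\<omega>. c (?X \<omega>) \<partial>P)"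
      unfolding LP_def by (rule integral_distr[OF XP]) measurable
    also have "\<dots> = (\<integral>\<omega>. c (?X \<omega>) * h \<omega> \<partial>R)"
      unfolding P using h by (subst integral_real_density) (auto simp: mult.commute)
    finally show ?thesis .
  qed
  have bounded_int: "integrable R (\<lambda>\<omega>. c (?X \<omega>) * f \<omega>)"
    if [measurable]: "c \<in> borel_measurable ?PT" and c: "\<And>x. \<bar>c x\<bar> \<le> C" and f: "integrable R f"
    for c f :: "(real \<Rightarrow> 'a) \<Rightarrow> real" and C
  proof (rule Bochner_Integration.integrable_bound[where f = "\<lambda>\<omega>. C * f \<omega>"])
    show "integrable R (\<lambda>\<omega>. C * f \<omega>)" using f by simp
    have [measurable]: "f \<in> borel_measurable R" using f by simp
    show "(\<lambda>\<omega>. c (?X \<omega>) * f \<omega>) \<in> borel_measurable R" by measurable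
    have "\<bar>c x\<bar> \<le> \<bar>C\<bar>" for x using c[of x] by simp
    then show "AE \<omega> in R. norm (c (?X \<omega>) * f \<omega>) \<le> norm (C * f \<omega>)"
      by (auto simp: abs_mult intro!: mult_right_mono)
  qed
  have on_D: "AE \<omega> in R. 1 / N \<le> g (?X \<omega>) \<and> g (?X \<omega>) \<le> N \<longrightarrow> h \<omega> = g (?X \<omega>)" if N: "1 \<le> N" for N :: real
  proof -
    define d :: "(real \<Rightarrow> 'a) \<Rightarrow> real" where "d x = of_bool (1 / N \<le> g x \<and> g x \<le> N)" for x
    have dm[measurable]: "d \<in> borel_measurable ?PT" unfolding d_def[abs_def] by measurable
    have d1: "\<bar>d x\<bar> \<le> 1" for x by (simp add: d_def)
    \<comment> \<open>\<open>h + k\<close> equals \<open>g(X\<^sub>T)\<close> on \<open>D\<close>, whose indicator is \<open>d\<close>, and \<open>h\<close> elsewhere.\<close>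
    define k where "k \<omega> = d (?X \<omega>) * (g (?X \<omega>) - h \<omega>)" for \<omega>
    have lnN: "\<bar>ln (g x)\<bar> \<le> ln N" if "d x \<noteq> 0" for x
    proof -
      have x: "1 / N \<le> g x" "g x \<le> N" using that by (auto simp: d_def split: if_splits)
      have "0 < g x" using x(1) N by (smt (verit) divide_pos_pos)
      moreover have "ln (1 / N) \<le> ln (g x)" using x N by (intro ln_mono) auto
      ultimately show ?thesis using x N by (auto simp: ln_div abs_le_iff intro!: ln_mono)
    qed
    have int_k: "integrable R k"
      unfolding k_def[abs_def] by (rule bounded_int[OF dm d1]) (use int_g int_h in simp)
    have hk: "0 \<le> h \<omega> + k \<omega>" for \<omega>
      using h[of \<omega>] g(4)[of "?X \<omega>"] by (auto simp: k_def d_def)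
    have phi_hk: "(h \<omega> + k \<omega>) * ln (h \<omega> + k \<omega>) - h \<omega> * ln (h \<omega>) =
        (d (?X \<omega>) * ln (g (?X \<omega>))) * g (?X \<omega>) - d (?X \<omega>) * (h \<omega> * ln (h \<omega>))" for \<omega>
      by (auto simp: k_def d_def)
    have dlnm[measurable]: "(\<lambda>x. d x * ln (g x)) \<in> borel_measurable ?PT" by measurable
    have dln: "\<bar>d x * ln (g x)\<bar> \<le> ln N" for x
      using lnN[of x] N by (cases "d x = 0") (auto simp: d_def)
    have int1: "integrable R (\<lambda>\<omega>. (d (?X \<omega>) * ln (g (?X \<omega>))) * g (?X \<omega>))"
      by (rule bounded_int[OF dlnm dln int_g])
    have int2: "integrable R (\<lambda>\<omega>. d (?X \<omega>) * (h \<omega> * ln (h \<omega>)))"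
      by (rule bounded_int[OF dm d1 hlnh])
    have var: "0 \<le> (\<integral>\<omega>. (h \<omega> + k \<omega>) * ln (h \<omega> + k \<omega>) - h \<omega> * ln (h \<omega>) \<partial>R)"
    proof (rule schroedinger_solution_first_variation[OF sol sf sets_R T hm h P hlnh int_k hk])
      show "emeasure R {\<omega> \<in> space R. k \<omega> \<noteq> 0} < \<infinity>"
      proof -
        have [measurable]: "k \<in> borel_measurable R" using int_k by simp
        have "emeasure R {\<omega> \<in> space R. k \<omega> \<noteq> 0} = (\<integral>\<^sup>+\<omega>. indicator {\<omega> \<in> space R. k \<omega> \<noteq> 0} \<omega> \<partial>R)"
          by simp
        also have "\<dots> \<le> (\<integral>\<^sup>+\<omega>. ennreal (N * g (?X \<omega>)) \<partial>R)"
        proof (rule nn_integral_mono)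
          fix \<omega>
          show "indicator {\<omega> \<in> space R. k \<omega> \<noteq> 0} \<omega> \<le> ennreal (N * g (?X \<omega>))"
          proof (cases "k \<omega> = 0")
            case False
            then have "1 / N \<le> g (?X \<omega>)" by (auto simp: k_def d_def split: if_splits)
            then have "1 \<le> N * g (?X \<omega>)" using N by (simp add: field_simps)
            then have "1 \<le> ennreal (N * g (?X \<omega>))" using ennreal_leI by fastforce
            then show ?thesis by (auto simp: indicator_def)
          qed simp
        qed
        also have "\<dots> < \<infinity>"
          using integrableD(2)[OF integrable_mult_right[OF int_g, of N]] N g(4) by (simp add: top.not_eq_extremum)
        finally show ?thesis .
      qed
      show "integrable R (\<lambda>\<omega>. (h \<omega> + k \<omega>) * ln (h \<omega> + k \<omega>) - h \<omega> * ln (h \<omega>))"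
        unfolding phi_hk using int1 int2 by (rule Bochner_Integration.integrable_diff)
      fix s and A :: "'a set" assume s: "s \<in> T" and A[measurable]: "A \<in> sets borel"
      define c :: "(real \<Rightarrow> 'a) \<Rightarrow> real" where "c x = indicator A (x s) * d x" for x
      have [measurable]: "(\<lambda>x. x s) \<in> measurable ?PT borel" using s by simp
      have cm[measurable]: "c \<in> borel_measurable ?PT" unfolding c_def[abs_def] by measurable
      have c1: "\<bar>c x\<bar> \<le> 1" for x by (auto simp: c_def d_def indicator_def)
      have "(\<integral>\<omega>. indicator A (\<omega> s) * k \<omega> \<partial>R) = (\<integral>\<omega>. c (?X \<omega>) * g (?X \<omega>) - c (?X \<omega>) * h \<omega> \<partial>R)"
        using s by (intro Bochner_Integration.integral_cong) (auto simp: c_def k_def algebra_simps)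
      also have "\<dots> = (\<integral>\<omega>. c (?X \<omega>) * g (?X \<omega>) \<partial>R) - (\<integral>\<omega>. c (?X \<omega>) * h \<omega> \<partial>R)"
        by (rule Bochner_Integration.integral_diff) (rule bounded_int[OF cm c1 int_g] bounded_int[OF cm c1 int_h])+
      finally show "(\<integral>\<omega>. indicator A (\<omega> s) * k \<omega> \<partial>R) = 0" using transfer[OF cm] by simp
    qed
    define e where "e x = d x * (1 + ln (g x))" for x
    have em[measurable]: "e \<in> borel_measurable ?PT" unfolding e_def[abs_def] by measurable
    have e1: "\<bar>e x\<bar> \<le> 1 + ln N" for x
      using lnN[of x] N by (cases "d x = 0") (auto simp: d_def e_def)
    \<comment> \<open>The Bregman divergence between \<open>h\<close> and \<open>g(X\<^sub>T)\<close> on \<open>D\<close>. Its linear part integrates to zero by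
    \<open>transfer\<close>.\<close>
    define B where "B \<omega> = d (?X \<omega>) * (h \<omega> * ln (h \<omega>)) - (d (?X \<omega>) * ln (g (?X \<omega>))) * g (?X \<omega>)
        - (e (?X \<omega>) * h \<omega> - e (?X \<omega>) * g (?X \<omega>))" for \<omega>
    have B_eq: "B \<omega> = d (?X \<omega>) * (h \<omega> * ln (h \<omega>) - g (?X \<omega>) * ln (g (?X \<omega>)) - (1 + ln (g (?X \<omega>))) * (h \<omega> - g (?X \<omega>)))" for \<omega>
      by (simp add: B_def e_def algebra_simps)
    have ie: "integrable R (\<lambda>\<omega>. e (?X \<omega>) * h \<omega>)" "integrable R (\<lambda>\<omega>. e (?X \<omega>) * g (?X \<omega>))"
      by (rule bounded_int[OF em e1 int_h] bounded_int[OF em e1 int_g])+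
    have int_B: "integrable R B"
      unfolding B_def[abs_def] using int1 int2 ie by simp
    have dpos: "0 < g (?X \<omega>)" if "d (?X \<omega>) \<noteq> 0" for \<omega>
      using that N by (auto simp: d_def intro: less_le_trans[of 0 "1 / N"] split: if_splits)
    have B_nn: "0 \<le> B \<omega>" for \<omega>
      using mult_ln_bregman(1)[OF h[of \<omega>] dpos[of \<omega>]] unfolding B_eq
      by (cases "d (?X \<omega>) = 0") (auto simp: d_def)
    have "(\<integral>\<omega>. B \<omega> \<partial>R) = - (\<integral>\<omega>. (h \<omega> + k \<omega>) * ln (h \<omega> + k \<omega>) - h \<omega> * ln (h \<omega>) \<partial>R)"
      unfolding phi_hk B_def using int1 int2 ie transfer[OF em] by simp
    then have "(\<integral>\<omega>. B \<omega> \<partial>R) = 0" using var integral_nonneg_AE[of B R] B_nn by simp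
    then have "AE \<omega> in R. B \<omega> = 0"
      using integral_nonneg_eq_0_iff_AE[OF int_B] B_nn by simp
    then show ?thesis
    proof eventually_elim
      case (elim \<omega>)
      show ?case
      proof
        assume "1 / N \<le> g (?X \<omega>) \<and> g (?X \<omega>) \<le> N"
        then have "d (?X \<omega>) = 1" by (simp add: d_def)
        with elim mult_ln_bregman(2)[OF h[of \<omega>] dpos[of \<omega>]] show "h \<omega> = g (?X \<omega>)"
          unfolding B_eq by simp
      qed
    qed
  qed
  have zero: "AE \<omega> in R. g (?X \<omega>) = 0 \<longrightarrow> h \<omega> = 0"
  proof -
    define c :: "(real \<Rightarrow> 'a) \<Rightarrow> real" where "c x = of_bool (g x = 0)" for x
    have cm[measurable]: "c \<in> borel_measurable ?PT" unfolding c_def[abs_def] by measurable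
    have c1: "\<bar>c x\<bar> \<le> 1" for x by (simp add: c_def)
    have c0: "c x * g x = 0" for x by (simp add: c_def)
    have "(\<integral>\<omega>. c (?X \<omega>) * h \<omega> \<partial>R) = 0" using transfer[OF cm] by (simp add: c0)
    then have "AE \<omega> in R. c (?X \<omega>) * h \<omega> = 0"
      using integral_nonneg_eq_0_iff_AE[OF bounded_int[OF cm c1 int_h]] h by (simp add: c_def)
    then show ?thesis by eventually_elim (simp add: c_def)
  qed
  have all: "AE \<omega> in R. \<forall>n. 1 / real (Suc n) \<le> g (?X \<omega>) \<and> g (?X \<omega>) \<le> real (Suc n) \<longrightarrow> h \<omega> = g (?X \<omega>)"
    unfolding AE_all_countable by (intro allI on_D) simp
  show thesis
  proof (rule that[OF gm g(4)])
    show "AE \<omega> in R. h \<omega> = g (?X \<omega>)"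
      using all zero
    proof eventually_elim
      case (elim \<omega>)
      show ?case
      proof (cases "g (?X \<omega>) = 0")
        case False
        then have pos: "0 < g (?X \<omega>)" using g(4)[of "?X \<omega>"] by simp
        obtain n where n: "max (1 / g (?X \<omega>)) (g (?X \<omega>)) < real n"
          using reals_Archimedean2 by blast
        then have "1 / g (?X \<omega>) \<le> real (Suc n)" "g (?X \<omega>) \<le> real (Suc n)" by auto
        moreover from this(1) have "1 / real (Suc n) \<le> g (?X \<omega>)" using pos by (simp add: field_simps)
        ultimately show ?thesis using elim(1) by blast
      qed (use elim in simp)
    qed
  qed
qed

section \<open>The optimal density is a product\<close>

text \<open>Transfers the first variation from path space to the finite product: a perturbation \<open>k\<close> of \<open>g\<close> is
  lifted to the perturbation \<open>k(X\<^sub>T)\<close> of the path density.\<close>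

lemma schroedinger_density_swap_invariant:
  fixes R P :: "(real \<Rightarrow> 'a::polish_space) measure" and g r :: "(real \<Rightarrow> 'a) \<Rightarrow> real"
    and \<rho> :: "real \<Rightarrow> 'a measure"
  assumes sol: "schroedinger_solution R T \<mu> P" and cond: "conditionable R"
    and T: "T \<subseteq> {0..1}" "T \<noteq> {}" "finite T"
    and \<rho>: "\<And>t. prob_space (\<rho> t)" "\<And>t. sets (\<rho> t) = sets borel"
    and gm: "g \<in> borel_measurable (\<Pi>\<^sub>M t\<in>T. borel)" and g: "\<And>x. 0 \<le> g x"
    and rm: "r \<in> borel_measurable (\<Pi>\<^sub>M t\<in>T. borel)" and r: "\<And>x. 0 < r x"
    and P: "P = density R (\<lambda>\<omega>. ennreal (g (restrict \<omega> T)))"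
    and glng: "integrable R (\<lambda>\<omega>. g (restrict \<omega> T) * ln (g (restrict \<omega> T)))"
    and law: "distr R (\<Pi>\<^sub>M t\<in>T. borel) (\<lambda>\<omega>. restrict \<omega> T) = density (PiM T \<rho>) (\<lambda>x. ennreal (r x))"
    and S: "S \<subseteq> T"
  shows "AE z in PiM T \<rho> \<Otimes>\<^sub>M PiM T \<rho>.
    g (fst z) * g (snd z) = g (fst (swap_coords S z)) * g (snd (swap_coords S z))"
proof (rule swap_invariant_if_optimal[OF \<rho>(1) T(3) S _ _ r g])
  let ?PT = "\<Pi>\<^sub>M t\<in>T. (borel :: 'a measure)" and ?m = "PiM T \<rho>"
  let ?X = "\<lambda>\<omega> :: real \<Rightarrow> 'a. restrict \<omega> T"
  have sets_m: "sets ?m = sets ?PT" by (intro sets_PiM_cong refl \<rho>(2))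
  have m_eq: "borel_measurable ?m = borel_measurable ?PT" by (intro measurable_cong_sets sets_m refl)
  show "r \<in> borel_measurable ?m" "g \<in> borel_measurable ?m" using rm gm by (simp_all only: m_eq)
  note [measurable] = rm gm
  have X[measurable]: "?X \<in> measurable R ?PT" by (rule measurable_restrict_R[OF cond T(1)])
  have sets_R: "sets R = sets path_borel" by (rule sets_conditionable[OF cond])
  interpret m: prob_space ?m by (rule prob_space_PiM) (rule \<rho>(1))
  have to_m: "(\<integral>\<omega>. f (?X \<omega>) \<partial>R) = (\<integral>x. f x * r x \<partial>?m)"
    and to_m_int: "integrable R (\<lambda>\<omega>. f (?X \<omega>)) \<longleftrightarrow> integrable ?m (\<lambda>x. f x * r x)"
    if f[measurable]: "f \<in> borel_measurable ?PT" for f :: "(real \<Rightarrow> 'a) \<Rightarrow> real"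
  proof -
    have fm: "f \<in> borel_measurable ?m" "r \<in> borel_measurable ?m" using f rm by (simp_all only: m_eq)
    have r0: "AE x in ?m. 0 \<le> r x" using r by (simp add: less_imp_le)
    have "(\<integral>\<omega>. f (?X \<omega>) \<partial>R) = (\<integral>x. f x \<partial>density ?m (\<lambda>x. ennreal (r x)))"
      unfolding law[symmetric] by (rule integral_distr[symmetric]) measurable
    also have "\<dots> = (\<integral>x. f x * r x \<partial>?m)"
      using integral_real_density[OF fm(2) r0 fm(1)] by (simp add: mult.commute)
    finally show "(\<integral>\<omega>. f (?X \<omega>) \<partial>R) = (\<integral>x. f x * r x \<partial>?m)" .
    have "integrable R (\<lambda>\<omega>. f (?X \<omega>)) \<longleftrightarrow> integrable (density ?m (\<lambda>x. ennreal (r x))) f"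
      unfolding law[symmetric] by (rule integrable_distr_eq[symmetric]) measurable
    also have "\<dots> \<longleftrightarrow> integrable ?m (\<lambda>x. f x * r x)"
      using integrable_real_density[OF fm(2) r0 fm(1)] by (simp add: mult.commute)
    finally show "integrable R (\<lambda>\<omega>. f (?X \<omega>)) \<longleftrightarrow> integrable ?m (\<lambda>x. f x * r x)" .
  qed
  fix k :: "(real \<Rightarrow> 'a) \<Rightarrow> real" and C :: real
  assume "k \<in> borel_measurable ?m" and kC: "\<And>x. \<bar>k x\<bar> \<le> C"
    and supp: "\<And>x. k x \<noteq> 0 \<Longrightarrow> r x \<le> C \<and> g x \<le> C" and gk: "\<And>x. 0 \<le> g x + k x"
    and marg: "\<And>i A. i \<in> T \<Longrightarrow> A \<in> sets (\<rho> i) \<Longrightarrow> (\<integral>x. indicator A (x i) * (k x * r x) \<partial>?m) = 0"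
  have km[measurable]: "k \<in> borel_measurable ?PT" using \<open>k \<in> borel_measurable ?m\<close> by (simp only: m_eq)
  have C0: "0 \<le> C" using kC[of undefined] by linarith
  have bounded_int: "integrable R (\<lambda>\<omega>. f (?X \<omega>))"
    if f[measurable]: "f \<in> borel_measurable ?PT" and "\<And>x. \<bar>f x\<bar> \<le> D" "\<And>x. k x = 0 \<Longrightarrow> f x = 0"
    for f :: "(real \<Rightarrow> 'a) \<Rightarrow> real" and D
    unfolding to_m_int[OF f]
  proof (rule m.integrable_const_bound[where B = "D * C"])
    have "\<bar>f x * r x\<bar> \<le> D * C" for x
    proof (cases "k x = 0")
      case True
      then show ?thesis using that(2)[of x] that(3)[of x] C0 by simp
    next
      case False
      then show ?thesis
        unfolding abs_mult using that(2)[of x] supp[of x] r[of x] by (intro mult_mono) auto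
    qed
    then show "AE x in ?m. norm (f x * r x) \<le> D * C" by simp
    show "(\<lambda>x. f x * r x) \<in> borel_measurable ?m" unfolding m_eq by measurable
  qed
  define F where "F x = (g x + k x) * ln (g x + k x) - g x * ln (g x)" for x
  have Fm[measurable]: "F \<in> borel_measurable ?PT" unfolding F_def[abs_def] by measurable
  have F_bound: "\<bar>F x\<bar> \<le> 2 * (1 + (2 * C) * (2 * C))" for x
  proof (cases "k x = 0")
    case False
    then have "g x \<le> 2 * C" "g x + k x \<le> 2 * C" using supp[of x] kC[of x] C0 by auto
    then have "\<bar>(g x + k x) * ln (g x + k x)\<bar> \<le> 1 + (2 * C) * (2 * C)" "\<bar>g x * ln (g x)\<bar> \<le> 1 + (2 * C) * (2 * C)"
      using abs_mult_ln_le gk[of x] g[of x] by blast+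
    from add_mono[OF this] show ?thesis
      unfolding F_def by (intro order_trans[OF abs_triangle_ineq4]) simp
  qed (simp add: F_def)
  have F_int: "integrable R (\<lambda>\<omega>. F (?X \<omega>))"
    by (rule bounded_int[OF Fm F_bound]) (simp add: F_def)
  have k_int: "integrable R (\<lambda>\<omega>. k (?X \<omega>))"
    by (rule bounded_int[OF km kC])
  have "0 \<le> (\<integral>\<omega>. F (?X \<omega>) \<partial>R)"
    unfolding F_def
  proof (rule schroedinger_solution_first_variation[OF sol sigma_finite_R[OF cond] sets_R T(1,2) _ g P glng k_int gk])
    show "(\<lambda>\<omega>. g (?X \<omega>)) \<in> borel_measurable R" by measurable
    show "integrable R (\<lambda>\<omega>. (g (?X \<omega>) + k (?X \<omega>)) * ln (g (?X \<omega>) + k (?X \<omega>)) - g (?X \<omega>) * ln (g (?X \<omega>)))"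
      using F_int by (simp only: F_def)
    define d :: "(real \<Rightarrow> 'a) \<Rightarrow> real" where "d x = of_bool (k x \<noteq> 0)" for x
    have dm: "d \<in> borel_measurable ?PT" and d1: "\<bar>d x\<bar> \<le> 1" for x
      by (simp_all add: d_def[abs_def])
    have "integrable R (\<lambda>\<omega>. d (?X \<omega>))"
      by (rule bounded_int[OF dm d1]) (simp add: d_def)
    then have "(\<integral>\<^sup>+\<omega>. ennreal (norm (d (?X \<omega>))) \<partial>R) < \<infinity>"
      by (simp add: integrable_iff_bounded)
    also have "(\<integral>\<^sup>+\<omega>. ennreal (norm (d (?X \<omega>))) \<partial>R) = (\<integral>\<^sup>+\<omega>. indicator {\<omega> \<in> space R. k (?X \<omega>) \<noteq> 0} \<omega> \<partial>R)"
      by (rule nn_integral_cong) (simp add: d_def indicator_def)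
    also have "\<dots> = emeasure R {\<omega> \<in> space R. k (?X \<omega>) \<noteq> 0}" by (rule nn_integral_indicator) measurable
    finally show "emeasure R {\<omega> \<in> space R. k (?X \<omega>) \<noteq> 0} < \<infinity>" .
    fix s and A :: "'a set" assume s: "s \<in> T" and A[measurable]: "A \<in> sets borel"
    have [measurable]: "(\<lambda>x. x s) \<in> measurable ?PT borel" using s by simp
    have "(\<integral>\<omega>. indicator A (\<omega> s) * k (?X \<omega>) \<partial>R) = (\<integral>\<omega>. indicator A (?X \<omega> s) * k (?X \<omega>) \<partial>R)"
      using s by simp
    also have "\<dots> = (\<integral>x. (indicator A (x s) * k x) * r x \<partial>?m)" by (rule to_m) measurable
    also have "\<dots> = 0" using marg[OF s] A \<rho>(2) by (simp add: mult.assoc)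
    finally show "(\<integral>\<omega>. indicator A (\<omega> s) * k (?X \<omega>) \<partial>R) = 0" .
  qed
  then show "integrable ?m (\<lambda>x. ((g x + k x) * ln (g x + k x) - g x * ln (g x)) * r x) \<and>
      0 \<le> (\<integral>x. ((g x + k x) * ln (g x + k x) - g x * ln (g x)) * r x \<partial>?m)"
    using to_m[OF Fm] to_m_int[OF Fm] F_int unfolding F_def by simp
qed

lemma schroedinger_density_product:
  fixes R P :: "(real \<Rightarrow> 'a::polish_space) measure"
  assumes markov: "Markov R" and irred: "irreducible_path_measure R"
    and T: "finite T" "T \<noteq> {}" "T \<subseteq> {0..1}"
    and sol: "schroedinger_solution R T \<mu> P"
  obtains f :: "real \<Rightarrow> 'a \<Rightarrow> real" where "\<And>s. s \<in> T \<Longrightarrow> f s \<in> borel_measurable borel" "\<And>s x. 0 \<le> f s x"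
    "P = density R (\<lambda>\<omega>. ennreal (\<Prod>s\<in>T. f s (\<omega> s)))"
proof -
  let ?PT = "\<Pi>\<^sub>M t\<in>T. (borel :: 'a measure)" and ?X = "\<lambda>\<omega> :: real \<Rightarrow> 'a. restrict \<omega> T"
  have cond: "conditionable R" using markov by (simp add: Markov_def)
  have sf: "sigma_finite_measure R" by (rule sigma_finite_R[OF cond])
  have X[measurable]: "?X \<in> measurable R ?PT" by (rule measurable_restrict_R[OF cond T(3)])
  have sets_P: "sets P = sets R" and prob_P: "prob_space P"
    using sol sets_conditionable[OF cond] by (simp_all add: schroedinger_solution_def schroedinger_feasible_def)
  interpret P: prob_space P by (rule prob_P)
  obtain h where h: "h \<in> borel_measurable R" "\<And>x. 0 \<le> h x" "P = density R (\<lambda>x. ennreal (h x))"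
      "integrable R (\<lambda>x. h x * ln (h x))"
    using finite_rel_entropy_density[OF sf sets_P prob_P] sol unfolding schroedinger_solution_def by metis
  obtain g where g: "g \<in> borel_measurable ?PT" "\<And>x. 0 \<le> g x" "AE \<omega> in R. h \<omega> = g (?X \<omega>)"
    using schroedinger_density_sufficient[OF sol cond T(3,2) h] by metis
  note [measurable] = g(1) h(1)
  have Pg: "P = density R (\<lambda>\<omega>. ennreal (g (?X \<omega>)))"
    unfolding h(3) by (rule density_cong) (use g(3) in auto)
  have glng: "integrable R (\<lambda>\<omega>. g (?X \<omega>) * ln (g (?X \<omega>)))"
    by (rule integrable_cong_AE_imp[OF h(4)]) (use g(3) in auto)
  have R_ne: "emeasure R (space R) \<noteq> 0"
  proof
    assume "emeasure R (space R) = 0"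
    then have "space R \<in> null_sets R" by (simp add: null_sets_def)
    then have "space R \<in> null_sets P"
      using absolutely_continuousI_density[of "\<lambda>x. ennreal (h x)" R] h(1,3) by (auto simp: absolutely_continuous_def)
    then show False using P.emeasure_space_1 sets_eq_imp_space_eq[OF sets_P] by (simp add: null_sets_def)
  qed
  have "\<exists>N. prob_space N \<and> sets N = sets borel \<and>
      (t \<in> {0..1} \<longrightarrow> (\<forall>A\<in>sets borel. emeasure N A = 0 \<longleftrightarrow> emeasure (marginal R t) A = 0))" for t :: real
  proof (cases "t \<in> {0..1}")
    case True
    have "emeasure (marginal R t) (space (marginal R t)) = emeasure R (space R)"
      unfolding marginal_def using measurable_canonical_R[OF cond True] by (simp add: emeasure_distr)
    then obtain N where "prob_space N" "sets N = sets (marginal R t)"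
        "\<And>A. A \<in> sets (marginal R t) \<Longrightarrow> emeasure N A = 0 \<longleftrightarrow> emeasure (marginal R t) A = 0"
      using equivalent_prob_measure[OF sigma_finite_marginal[OF cond True]] R_ne by metis
    then show ?thesis by (auto simp: marginal_def)
  next
    case False
    then show ?thesis
      by (intro exI[of _ "return borel undefined"]) (auto intro!: prob_space_return)
  qed
  then obtain \<rho> where \<rho>: "\<And>t. prob_space (\<rho> t)" "\<And>t. sets (\<rho> t) = sets (borel :: 'a measure)"
      "\<And>t A. t \<in> {0..1} \<Longrightarrow> A \<in> sets borel \<Longrightarrow> emeasure (\<rho> t) A = 0 \<longleftrightarrow> emeasure (marginal R t) A = 0"
    by metis
  let ?m = "PiM T \<rho>"
  define L where "L = distr R ?PT ?X"
  have null: "emeasure L B = 0 \<longleftrightarrow> emeasure ?m B = 0" if "B \<in> sets ?PT" for B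
    unfolding L_def by (rule law_null_iff_product_null[OF markov irred \<rho> T that])
  have sets_m: "sets ?m = sets ?PT" by (intro sets_PiM_cong refl \<rho>(2))
  have sets_L: "sets L = sets ?PT" by (simp add: L_def)
  have m_eq: "borel_measurable ?m = borel_measurable ?PT" by (intro measurable_cong_sets sets_m refl)
  interpret m: prob_space ?m by (rule prob_space_PiM) (rule \<rho>(1))
  obtain s0 where s0: "s0 \<in> T" using T by auto
  have sfL: "sigma_finite_measure L" unfolding L_def by (rule sigma_finite_restrict_R[OF cond T(3) s0])
  have ac: "absolutely_continuous ?m L" "absolutely_continuous L ?m"
    using null sets_m sets_L by (auto simp: absolutely_continuous_def null_sets_def)
  have sets_Lm: "sets L = sets ?m" using sets_L sets_m by simp
  define r0 where "r0 = RN_deriv ?m L"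
  have r0m: "r0 \<in> borel_measurable ?m" by (simp add: r0_def)
  have Lr0: "L = density ?m r0"
    unfolding r0_def by (rule m.density_RN_deriv[OF ac(1) sets_Lm, symmetric])
  have fin: "AE x in ?m. r0 x \<noteq> \<infinity>"
    unfolding r0_def by (rule m.RN_deriv_finite[OF sfL ac(1) sets_Lm])
  have pos: "AE x in ?m. r0 x \<noteq> 0"
  proof -
    have Z: "{x \<in> space ?m. r0 x = 0} \<in> sets ?m" using r0m by measurable
    then have "{x \<in> space ?m. r0 x = 0} \<in> null_sets L"
      unfolding Lr0 using r0m by (subst null_sets_density_iff) auto
    then have "{x \<in> space ?m. r0 x = 0} \<in> null_sets ?m"
      using ac(2) by (auto simp: absolutely_continuous_def)
    then show ?thesis by (rule AE_I') auto
  qed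
  \<comment> \<open>A real-valued version that is positive everywhere; the value \<open>1\<close> is taken on a null set.\<close>
  define r where "r x = (if r0 x = 0 \<or> r0 x = \<infinity> then 1 else enn2real (r0 x))" for x
  have rm: "r \<in> borel_measurable ?PT"
    using r0m unfolding m_eq[symmetric] r_def[abs_def] by measurable
  have r: "0 < r x" for x
    by (auto simp: r_def enn2real_positive_iff zero_less_iff_neq_zero less_top)
  have law: "distr R ?PT ?X = density ?m (\<lambda>x. ennreal (r x))"
    unfolding L_def[symmetric] Lr0
  proof (rule density_cong)
    show "AE x in ?m. r0 x = ennreal (r x)"
      using fin pos by eventually_elim (simp add: r_def less_top)
    show "(\<lambda>x. ennreal (r x)) \<in> borel_measurable ?m"
      using rm unfolding m_eq[symmetric] by measurable
  qed (rule r0m)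
  have swap: "AE z in ?m \<Otimes>\<^sub>M ?m.
      g (fst z) * g (snd z) = g (fst (swap_coords {s} z)) * g (snd (swap_coords {s} z))" if "s \<in> T" for s
    by (rule schroedinger_density_swap_invariant[OF sol cond T(3,2,1) \<rho>(1,2) g(1,2) rm r Pg glng law])
      (use that in simp)
  have gm: "g \<in> borel_measurable ?m" unfolding m_eq by (rule g(1))
  obtain f where f: "\<And>s. s \<in> T \<Longrightarrow> f s \<in> borel_measurable (\<rho> s)" "\<And>s x. 0 \<le> f s x"
      "AE x in ?m. g x = (\<Prod>s\<in>T. f s (x s))"
    by (rule swap_invariant_factorization[OF \<rho>(1) T(1) gm g(2) T(2) swap]) blast+
  have fb[measurable]: "f s \<in> borel_measurable borel" if "s \<in> T" for s
    using f(1)[OF that] measurable_cong_sets[OF \<rho>(2)[of s] refl] by blast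
  have "AE x in L. g x = (\<Prod>s\<in>T. f s (x s))"
    using absolutely_continuous_AE[OF sets_Lm ac(1) f(3)] .
  then have AE_R: "AE \<omega> in R. g (?X \<omega>) = (\<Prod>s\<in>T. f s (?X \<omega> s))"
    unfolding L_def by (rule AE_distrD[OF X])
  show thesis
  proof (rule that[OF fb f(2)])
    show "P = density R (\<lambda>\<omega>. ennreal (\<Prod>s\<in>T. f s (\<omega> s)))"
      unfolding Pg
    proof (rule density_cong)
      show "AE \<omega> in R. ennreal (g (?X \<omega>)) = ennreal (\<Prod>s\<in>T. f s (\<omega> s))"
        using AE_R by eventually_elim (simp cong: prod.cong)
      have "(\<lambda>\<omega>. f s (\<omega> s)) \<in> borel_measurable R" if "s \<in> T" for s
        using measurable_compose[OF measurable_canonical_R[OF cond] fb[OF that]] T(3) that by blast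
      then show "(\<lambda>\<omega>. ennreal (\<Prod>s\<in>T. f s (\<omega> s))) \<in> borel_measurable R" by measurable
    qed measurable
  qed
qed

section \<open>Contents with finitely many atoms\<close>

text \<open>Close to \<open>(s, t)\<close>, an atom on one side of \<open>s\<close> or of \<open>t\<close> stays on the same side of \<open>\<sigma>\<close> or of
  \<open>\<tau>\<close>; the direction of approach decides about atoms at \<open>s\<close> and \<open>t\<close> themselves. So the content is
  eventually constant.\<close>

lemma tendsto_atomic_content:
  fixes v :: "real \<Rightarrow> ereal"
  assumes T: "finite T"
    and eq: "\<And>\<sigma> \<tau>. (\<sigma>, \<tau>) \<in> Z \<Longrightarrow>
      (\<And>u. u \<in> T \<Longrightarrow> (u < s \<longrightarrow> u < \<sigma>) \<and> (s < u \<longrightarrow> \<sigma> < u) \<and> (u < t \<longrightarrow> u < \<tau>) \<and> (t < u \<longrightarrow> \<tau> < u)) \<Longrightarrow>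
      J \<sigma> \<tau> \<inter> T = J0 \<inter> T"
  shows "((\<lambda>(\<sigma>, \<tau>). \<Sum>u\<in>J \<sigma> \<tau> \<inter> T. v u) \<longlongrightarrow> (\<Sum>u\<in>J0 \<inter> T. v u)) (at (s, t) within Z)"
proof (rule tendsto_eventually)
  have fst_lim: "(fst \<longlongrightarrow> s) (at (s, t) within Z)" and snd_lim: "(snd \<longlongrightarrow> t) (at (s, t) within Z)"
    using tendsto_fst[OF tendsto_ident_at, of "(s, t)" Z] tendsto_snd[OF tendsto_ident_at, of "(s, t)" Z]
    by simp_all
  have "\<forall>\<^sub>F p in at (s, t) within Z. \<forall>u\<in>T.
      (u < s \<longrightarrow> u < fst p) \<and> (s < u \<longrightarrow> fst p < u) \<and> (u < t \<longrightarrow> u < snd p) \<and> (t < u \<longrightarrow> snd p < u)"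
    using order_tendstoD[OF fst_lim] order_tendstoD[OF snd_lim]
    by (intro eventually_ball_finite[OF T] ballI eventually_conj) (auto simp: eventually_const_iff)
  moreover have "\<forall>\<^sub>F p in at (s, t) within Z. p \<in> Z"
    by (simp add: eventually_at_filter)
  ultimately show "\<forall>\<^sub>F p in at (s, t) within Z.
      (case p of (\<sigma>, \<tau>) \<Rightarrow> \<Sum>u\<in>J \<sigma> \<tau> \<inter> T. v u) = (\<Sum>u\<in>J0 \<inter> T. v u)"
  proof eventually_elim
    case (elim p)
    then have "J (fst p) (snd p) \<inter> T = J0 \<inter> T" by (intro eq) auto
    then show ?case by (simp add: case_prod_beta)
  qed
qed

lemma regular_content_atomic:
  fixes v :: "real \<Rightarrow> ereal"
  assumes T: "finite T" and v: "\<And>u. v u \<noteq> \<infinity>"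
  shows "regular_content (\<lambda>I. \<Sum>u\<in>I \<inter> T. v u)"
proof -
  have fin: "(\<Sum>u\<in>I \<inter> T. v u) \<noteq> \<infinity>" for I
    using v by (simp add: sum_Pinfty)
  have "(\<Sum>u\<in>(I \<union> J) \<inter> T. v u) = (\<Sum>u\<in>I \<inter> T. v u) + (\<Sum>u\<in>J \<inter> T. v u)" if "I \<inter> J = {}" for I J
  proof -
    have "(I \<union> J) \<inter> T = (I \<inter> T) \<union> (J \<inter> T)" by auto
    then show ?thesis using T that by (simp only:) (intro sum.union_disjoint; auto)
  qed
  then have "is_content (\<lambda>I. \<Sum>u\<in>I \<inter> T. v u)"
    using fin by (simp add: is_content_def)
  moreover have "regular_closed (\<lambda>I. \<Sum>u\<in>I \<inter> T. v u)"
    unfolding regular_closed_def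
  proof (intro conjI allI impI)
    fix s t :: real
    show "((\<lambda>(\<sigma>, \<tau>). \<Sum>u\<in>{\<sigma>..\<tau>} \<inter> T. v u) \<longlongrightarrow> (\<Sum>u\<in>{s..t} \<inter> T. v u))
        (at (s, t) within {(\<sigma>, \<tau>). \<sigma> \<in> {0..1} \<and> \<tau> \<in> {0..1} \<and> \<sigma> \<le> s \<and> t \<le> \<tau>})"
      by (rule tendsto_atomic_content[OF T]) (fastforce simp: not_le[symmetric])
    have "((\<lambda>(\<sigma>, \<tau>). \<Sum>u\<in>{\<sigma>..\<tau>} \<inter> T. v u) \<longlongrightarrow> (\<Sum>u\<in>{s<..<t} \<inter> T. v u))
        (at (s, t) within {(\<sigma>, \<tau>). \<sigma> \<in> {0..1} \<and> \<tau> \<in> {0..1} \<and> s < \<sigma> \<and> \<tau> < t})"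
      by (rule tendsto_atomic_content[OF T]) (fastforce simp: not_le[symmetric])
    then show "\<exists>l. l \<noteq> \<infinity> \<and> ((\<lambda>(\<sigma>, \<tau>). \<Sum>u\<in>{\<sigma>..\<tau>} \<inter> T. v u) \<longlongrightarrow> l)
        (at (s, t) within {(\<sigma>, \<tau>). \<sigma> \<in> {0..1} \<and> \<tau> \<in> {0..1} \<and> s < \<sigma> \<and> \<tau> < t})"
      using fin by blast
  qed
  moreover have "regular_open (\<lambda>I. \<Sum>u\<in>I \<inter> T. v u)"
    unfolding regular_open_def
  proof (intro conjI allI impI)
    fix s t :: real
    show "((\<lambda>(\<sigma>, \<tau>). \<Sum>u\<in>{\<sigma><..<\<tau>} \<inter> T. v u) \<longlongrightarrow> (\<Sum>u\<in>{s<..<t} \<inter> T. v u))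
        (at (s, t) within {(\<sigma>, \<tau>). \<sigma> \<in> {0..1} \<and> \<tau> \<in> {0..1} \<and> s \<le> \<sigma> \<and> \<tau> \<le> t})"
      by (rule tendsto_atomic_content[OF T]) (fastforce simp: not_le[symmetric])
    have "((\<lambda>(\<sigma>, \<tau>). \<Sum>u\<in>{\<sigma><..<\<tau>} \<inter> T. v u) \<longlongrightarrow> (\<Sum>u\<in>{s..t} \<inter> T. v u))
        (at (s, t) within {(\<sigma>, \<tau>). \<sigma> \<in> {0..1} \<and> \<tau> \<in> {0..1} \<and> \<sigma> < s \<and> t < \<tau>})"
      by (rule tendsto_atomic_content[OF T]) (fastforce simp: not_le[symmetric])
    then show "\<exists>l. l \<noteq> \<infinity> \<and> ((\<lambda>(\<sigma>, \<tau>). \<Sum>u\<in>{\<sigma><..<\<tau>} \<inter> T. v u) \<longlongrightarrow> l)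
        (at (s, t) within {(\<sigma>, \<tau>). \<sigma> \<in> {0..1} \<and> \<tau> \<in> {0..1} \<and> \<sigma> < s \<and> t < \<tau>})"
      using fin by blast
  qed
  ultimately show ?thesis by (simp add: regular_content_def)
qed

lemma exp_ereal_add:
  assumes "a \<noteq> \<infinity>" "b \<noteq> \<infinity>"
  shows "exp_ereal (a + b) = exp_ereal a * exp_ereal b"
  using assms by (cases a; cases b) (simp_all add: exp_ereal_def exp_add ennreal_mult)

lemma exp_ereal_sum:
  assumes "finite S" "\<And>s. s \<in> S \<Longrightarrow> v s \<noteq> \<infinity>"
  shows "exp_ereal (\<Sum>s\<in>S. v s) = (\<Prod>s\<in>S. exp_ereal (v s))"
  using assms
proof (induction S rule: finite_induct)
  case (insert s S)
  then have "exp_ereal (v s + (\<Sum>s\<in>S. v s)) = exp_ereal (v s) * exp_ereal (\<Sum>s\<in>S. v s)"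
    by (intro exp_ereal_add) (auto simp: sum_Pinfty)
  with insert show ?case by simp
qed (simp add: exp_ereal_def zero_ereal_def)

section \<open>The optimal density as the exponential of an additive functional\<close>

theorem theorem5p1:
  fixes R P :: "(real \<Rightarrow> 'a::polish_space) measure"
    and K :: nat
    and t :: "nat \<Rightarrow> real"
    and T :: "real set"
    and \<mu> :: "real \<Rightarrow> 'a measure"
  assumes "sets R = sets path_borel"
    and "Markov R"
    and "irreducible_path_measure R"
    and "1 \<le> K"
    and "inj_on t {1..K}"
    and "T = t ` {1..K}"
    and "T \<subseteq> {0..1}"
    and "\<forall>s\<in>T. prob_space (\<mu> s) \<and> sets (\<mu> s) = sets borel"
    and "schroedinger_solution R T \<mu> P"
  shows "\<exists>(A :: (real \<Rightarrow> 'a) \<Rightarrow> real set \<Rightarrow> ereal) (f :: nat \<Rightarrow> 'a \<Rightarrow> ereal).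
    regular_additive_functional A \<and>
    (\<forall>i\<in>{1..K}. f i \<in> borel_measurable borel \<and> (\<forall>x. f i x \<noteq> \<infinity>)) \<and>
    absolutely_continuous R P \<and>
    (AE \<omega> in R. RN_deriv R P \<omega> = exp_ereal (A \<omega> {0..1})) \<and>
    (\<forall>I\<in>unit_intervals. I \<inter> T = {} \<longrightarrow> (\<forall>\<omega>\<in>paths. A \<omega> I = 0)) \<and>
    (\<forall>I\<in>unit_intervals. (\<lambda>\<omega>. A \<omega> I) \<in> borel_measurable (path_sigma (I \<inter> T))) \<and>
    (\<forall>\<omega>\<in>paths. A \<omega> {0..1} = (\<Sum>i=1..K. f i (canonical (t i) \<omega>)))"
proof -
  have T: "finite T" "T \<noteq> {}" "T \<subseteq> {0..1}" using assms(4,6,7) by auto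
  have cond: "conditionable R" using assms(2) by (simp add: Markov_def)
  obtain F :: "real \<Rightarrow> 'a \<Rightarrow> real" where F: "\<And>s. s \<in> T \<Longrightarrow> F s \<in> borel_measurable borel" "\<And>s x. 0 \<le> F s x"
      and P: "P = density R (\<lambda>\<omega>. ennreal (\<Prod>s\<in>T. F s (\<omega> s)))"
    using schroedinger_density_product[OF assms(2,3) T assms(9)] by metis
  define v :: "real \<Rightarrow> 'a \<Rightarrow> ereal" where "v s x = (if F s x = 0 then - \<infinity> else ereal (ln (F s x)))" for s x
  define A :: "(real \<Rightarrow> 'a) \<Rightarrow> real set \<Rightarrow> ereal" where "A \<omega> I = (\<Sum>s\<in>I \<inter> T. v s (\<omega> s))" for \<omega> I
  have v_fin: "v s x \<noteq> \<infinity>" for s x by (simp add: v_def)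
  have v_exp: "exp_ereal (v s x) = ennreal (F s x)" for s x
    using F(2)[of s x] by (auto simp: v_def exp_ereal_def)
  have vm: "v s \<in> borel_measurable borel" if "s \<in> T" for s
    using F(1)[OF that] unfolding v_def[abs_def] by measurable
  have A_meas: "(\<lambda>\<omega>. A \<omega> I) \<in> borel_measurable (path_sigma J)" if "I \<inter> T \<subseteq> J" for I J
    unfolding A_def
  proof (rule borel_measurable_ereal_sum)
    fix s assume "s \<in> I \<inter> T"
    then show "(\<lambda>\<omega>. v s (\<omega> s)) \<in> borel_measurable (path_sigma J)"
      using that by (intro measurable_compose[OF measurable_canonical_path_sigma vm]) auto
  qed
  have A_reg: "regular_content (A \<omega>)" for \<omega>
    unfolding A_def[abs_def] by (rule regular_content_atomic[OF T(1) v_fin])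
  have A_exp: "exp_ereal (A \<omega> {0..1}) = ennreal (\<Prod>s\<in>T. F s (\<omega> s))" for \<omega>
  proof -
    have "{0..1} \<inter> T = T" using T(3) by auto
    then show ?thesis
      using T(1) F(2) by (simp add: A_def exp_ereal_sum v_fin v_exp prod_ennreal)
  qed
  have Fm: "(\<lambda>\<omega>. ennreal (\<Prod>s\<in>T. F s (\<omega> s))) \<in> borel_measurable R"
  proof -
    have "(\<lambda>\<omega>. F s (\<omega> s)) \<in> borel_measurable R" if "s \<in> T" for s
      using measurable_compose[OF measurable_canonical_R[OF cond] F(1)[OF that]] T(3) that by blast
    then show ?thesis by measurable
  qed
  have "regular_additive_functional A"
    using A_reg A_meas unfolding regular_additive_functional_def additive_functional_def regular_content_def by auto
  moreover have "\<forall>i\<in>{1..K}. v (t i) \<in> borel_measurable borel \<and> (\<forall>x. v (t i) x \<noteq> \<infinity>)"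
    using vm v_fin assms(6) by auto
  moreover have "absolutely_continuous R P"
    unfolding P by (rule absolutely_continuousI_density[OF Fm])
  moreover have "AE \<omega> in R. RN_deriv R P \<omega> = exp_ereal (A \<omega> {0..1})"
    using sigma_finite_measure.RN_deriv_unique[OF sigma_finite_R[OF cond] Fm P[symmetric]]
    by eventually_elim (simp add: A_exp)
  moreover have "\<forall>I\<in>unit_intervals. I \<inter> T = {} \<longrightarrow> (\<forall>\<omega>\<in>paths. A \<omega> I = 0)"
    by (simp add: A_def)
  moreover have "\<forall>I\<in>unit_intervals. (\<lambda>\<omega>. A \<omega> I) \<in> borel_measurable (path_sigma (I \<inter> T))"
    using A_meas by simp
  moreover have "\<forall>\<omega>\<in>paths. A \<omega> {0..1} = (\<Sum>i=1..K. v (t i) (\<omega> (t i)))"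
  proof
    fix \<omega> :: "real \<Rightarrow> 'a"
    have "{0..1} \<inter> T = t ` {1..K}" using T(3) assms(6) by auto
    then show "A \<omega> {0..1} = (\<Sum>i=1..K. v (t i) (\<omega> (t i)))"
      by (simp only: A_def sum.reindex[OF assms(5)] comp_def)
  qed
  ultimately show ?thesis by (intro exI[of _ A] exI[of _ "\<lambda>i. v (t i)"] conjI)
qed

end
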